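(* Suppose $0<d<1/2$ is constant and let $\theta=\ln d^{-1}$. For $H\in\mathcal{D}(n,d)$ and an integer $m$, let $D=H+R$, where $R$ is a uniformly random set of $m$ arcs chosen from $\overline{A}=[n]^2\setminus A(H)$. (a) If $m\ge\left(d^{-1}(15+6\theta)+5d^{-2}\right)n$, then $D$ is Hamiltonian whp. (That is, for every choice of $H=H_n\in\mathcal{D}(n,d)$ and every $m=m(n)$ satisfying this bound, $D$ is Hamiltonian whp.) (b) If $d\le 1/10$, then there exist digraphs $H=H_n\in\mathcal{D}(n,d)$ (one for each sufficiently large $n$) such that if $m=m(n)<\theta n/3$, then whp $D$ is not Hamiltonian.
   Context: $[n]=\{1,\dots,n\}$ and $[n]^2$ is the set of ordered pairs of elements of $[n]$. For a digraph $D$, $A(D)$ denotes its arc set, $\delta^+$ its minimum out-degree, $\delta^-$ its minimum in-degree, and $\delta=\min\{\delta^+,\delta^-\}$. Digraphs have no parallel arcs (oppositely directed arcs are allowed), and the digraphs $H$ in $\mathcal{D}(n,d)$ have no loops. For a constant $0<d<1$, $\mathcal{D}(n,d)$ denotes the set of digraphs with vertex set $[n]$ and $\delta\ge dn$. For a digraph $H$ on $[n]$ and a set $R$ of arcs, $H+R$ is the digraph on $[n]$ with arc set $A(H)\cup R$. It is implicit that $0\le m\le|\overline{A}|$, so that a set $R\subseteq\overline{A}$ with $|R|=m$ exists. A digraph is Hamiltonian if it contains a directed cycle through all its vertices. A sequence of events $\mathcal{E}_n$ occurs "with high probability" (whp) if $\lim_{n\to\infty}\Pr(\mathcal{E}_n)=1$.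 *)

theory Defs
  imports "Graph_Theory.Pair_Digraph" "HOL-Probability.Probability_Mass_Function"
begin

definition min_out_degree :: "('a, 'b) pre_digraph \<Rightarrow> nat" where
  "min_out_degree G = Min (out_degree G ` verts G)"

definition min_in_degree :: "('a, 'b) pre_digraph \<Rightarrow> nat" where
  "min_in_degree G = Min (in_degree G ` verts G)"

definition min_semidegree :: "('a, 'b) pre_digraph \<Rightarrow> nat" where
  "min_semidegree G = min (min_out_degree G) (min_in_degree G)"

text \<open>Arcs are pairs of vertices, so there are no parallel arcs; \<open>pair_digraph\<close> excludes
  loops but not pairs of opposite arcs.\<close>

definition dense_digraphs :: "nat \<Rightarrow> real \<Rightarrow> nat pair_pre_digraph set" where
  "dense_digraphs n d =
     {H. pair_digraph H \<and> pverts H = {1..n} \<and> real (min_semidegree (with_proj H)) \<ge> d * real n}"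

text \<open>A cycle in the sense of the library is a nonempty closed walk, given by its list of arcs,
  that repeats no vertex; the vertices on it are the tails of its arcs.\<close>

definition hamiltonian :: "('a, 'b) pre_digraph \<Rightarrow> bool" where
  "hamiltonian G \<longleftrightarrow> (\<exists>p. pre_digraph.cycle G p \<and> tail G ` set p = verts G)"

text \<open>The complement is taken in the set of all ordered pairs, so for loop-free \<open>H\<close> it contains every loop.\<close>

definition missing_arcs :: "'a pair_pre_digraph \<Rightarrow> ('a \<times> 'a) set" where
  "missing_arcs H = pverts H \<times> pverts H - parcs H"

definition add_arcs :: "'a pair_pre_digraph \<Rightarrow> ('a \<times> 'a) set \<Rightarrow> 'a pair_pre_digraph" where
  "add_arcs H R = H\<lparr>parcs := parcs H \<union> R\<rparr>"

text \<open>Meaningful only for finite \<open>pverts H\<close> and \<open>m \<le> card (missing_arcs H)\<close>: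
  otherwise there is no set to draw from and \<open>pmf_of_set\<close> is unspecified.\<close>

definition perturbed_digraph :: "'a pair_pre_digraph \<Rightarrow> nat \<Rightarrow> 'a pair_pre_digraph pmf" where
  "perturbed_digraph H m =
     map_pmf (add_arcs H) (pmf_of_set {R. R \<subseteq> missing_arcs H \<and> card R = m})"

definition whp :: "(nat \<Rightarrow> 'a pmf) \<Rightarrow> ('a \<Rightarrow> bool) \<Rightarrow> bool" where
  "whp X P \<longleftrightarrow> (\<lambda>n. measure_pmf.prob (X n) {x. P x}) \<longlonglongrightarrow> 1"

end

theory Submission
  imports Defs "HOL-Real_Asymp.Real_Asymp"
begin

text \<open>
  Part (a) separates into a property of random arcs and a deterministic theorem. Fix a size \<open>k\<close>
  slightly below \<open>dn/4\<close>. The random arcs make \<open>D\<close> \<^emph>\<open>joined\<close>: between any two disjoint sets of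
  \<open>k\<close> vertices there is an arc in each direction (\<open>prob_not_joined\<close>). This is a union bound over
  the \<open>(n choose k)^2\<close> pairs of sets: a pair that is not already joined by \<open>H\<close> offers \<open>k^2\<close>
  missing arcs, and \<open>R\<close> avoids all of them with probability at most \<open>(1 - k^2/n^2)^m\<close>. The
  bound on \<open>m\<close> in (a) is strong enough for \<open>k = 6dn/25\<close>. The deterministic theorem
  (\<open>spanning_cyclic_path_exists\<close>) says that a joined digraph with all in- and out-degrees at
  least \<open>4k\<close> is Hamiltonian.

  For the deterministic theorem, add a virtual loop at every vertex, so that the vertex set is
  covered by disjoint cycles, namely by the loops. Take a cover with the fewest cycles, and let
  \<open>\<sigma>\<close> map each vertex to the next one on its cycle. Suppose that it has at least two cycles, and
  let \<open>w\<close> be any vertex. Replacing the outgoing cycle arcs of four vertices along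
  \<open>w \<rightarrow> y \<rightarrow> z \<rightarrow> x \<rightarrow> w\<close>, that is, using the arcs \<open>(w, \<sigma> y)\<close>, \<open>(y, \<sigma> z)\<close>, \<open>(z, \<sigma> x)\<close> and
  \<open>(x, \<sigma> w)\<close>, gives another cover. The degrees supply many \<open>y\<close> and \<open>x\<close> for the first and the last
  of these arcs, and joinedness supplies a \<open>z\<close> for the middle two once \<open>x\<close>, \<open>y\<close> and \<open>z\<close> range over
  sets of sizes \<open>k\<close>, \<open>k\<close> and \<open>2k\<close> (\<open>connect_via_one\<close>). Since a 4-cycle is an odd permutation, the
  number of cycles changes by an odd number; it drops for nearly every relative position of the
  four vertices, and the counting in \<open>few_neighbours_outside\<close> finds vertices in a good position
  unless almost all possible \<open>x\<close> and \<open>y\<close> lie on the cycle of \<open>w\<close>. In that remaining case all cycles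
  are long, and an exchange at six vertices merges two of them (\<open>exchange_two_cycles\<close>).

  For part (b) take \<open>H\<close> to be complete bipartite, in both directions, between a set of about \<open>dn\<close>
  vertices and the set \<open>B\<close> of all others. A vertex of \<open>B\<close> from which no arc of \<open>R\<close> leaves must be
  followed by one of the \<open>dn\<close> vertices outside \<open>B\<close> on a Hamilton cycle
  (\<open>hamiltonian_bipartite_bound\<close>). A vertex of \<open>B\<close> is of this kind with probability about
  \<open>exp (- m / card B)\<close> or more, which for \<open>m < \<theta>n/3\<close> is at least \<open>sqrt d\<close>; so at least
  \<open>4/5 * sqrt d * n\<close> such vertices are expected, which is more than \<open>2dn\<close>. The events for
  different vertices are negatively correlated, hence Chebyshev's inequality shows that whp the
  number of such vertices exceeds \<open>dn\<close> by a constant fraction of \<open>n\<close> (\<open>few_events_unlikely\<close>).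
\<close>

section \<open>Cycle covers and exchanges\<close>

text \<open>
  A cycle is given by the list of its vertices. For a reflexive \<open>E\<close> every one-element list
  qualifies, so the vertices form a cover by themselves.
\<close>
definition cyclic_path :: "('a \<Rightarrow> 'a \<Rightarrow> bool) \<Rightarrow> 'a list \<Rightarrow> bool" where
  "cyclic_path E c \<longleftrightarrow> c \<noteq> [] \<and> successively E c \<and> E (last c) (hd c)"

definition cycle_cover :: "('a \<Rightarrow> 'a \<Rightarrow> bool) \<Rightarrow> 'a set \<Rightarrow> 'a list list \<Rightarrow> bool" where
  "cycle_cover E V css \<longleftrightarrow>
     (\<forall>c\<in>set css. cyclic_path E c) \<and> distinct (concat css) \<and> set (concat css) = V"

text \<open>
  The successor of \<open>u\<close> is read off from a splitting \<open>p @ u # q\<close> of its cycle; the form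
  \<open>hd (q @ p @ [u])\<close> covers the last vertex of the list and the one-element list as well.
\<close>
definition follows :: "('a \<Rightarrow> 'a) \<Rightarrow> 'a list list \<Rightarrow> bool" where
  "follows \<sigma> css \<longleftrightarrow> (\<forall>c\<in>set css. \<forall>p u q. c = p @ u # q \<longrightarrow> \<sigma> u = hd (q @ p @ [u]))"

lemma cyclic_path_rotate: "cyclic_path E (a @ b) \<Longrightarrow> cyclic_path E (b @ a)"
  by (cases "a = []"; cases "b = []") (auto simp: cyclic_path_def successively_append_iff)

lemma cycle_cover_cong:
  assumes "cycle_cover E V css" "\<And>c. c \<in> set css' \<Longrightarrow> cyclic_path E c"
    "mset (concat css') = mset (concat css)"
  shows "cycle_cover E V css'"
  using assms mset_eq_imp_distinct_iff[OF assms(3)] mset_eq_setD[OF assms(3)]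
  unfolding cycle_cover_def by simp

lemma follows_inner:
  assumes "follows \<sigma> css" "A @ B \<in> set css" "A \<noteq> []" "B \<noteq> []"
  shows "\<sigma> (last A) = hd B"
proof -
  have "A @ B = butlast A @ last A # B" using assms(3) by simp
  then have "\<sigma> (last A) = hd (B @ butlast A @ [last A])"
    using assms(1,2) unfolding follows_def by blast
  then show ?thesis using assms(4) by simp
qed

lemma follows_last:
  assumes "follows \<sigma> css" "c \<in> set css" "c \<noteq> []"
  shows "\<sigma> (last c) = hd c"
proof -
  have "c = butlast c @ last c # []" using assms(3) by simp
  then have "\<sigma> (last c) = hd ([] @ butlast c @ [last c])"
    using assms(1,2) unfolding follows_def by blast
  then show ?thesis using assms(3) by simp
qed

lemma follows_rotate:
  assumes "follows \<sigma> ((a @ b) # css)"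
  shows "follows \<sigma> ((b @ a) # css)"
  unfolding follows_def
proof (intro ballI allI impI)
  fix c p u q
  assume c: "c \<in> set ((b @ a) # css)" and eq: "c = p @ u # q"
  show "\<sigma> u = hd (q @ p @ [u])"
  proof (cases "c = b @ a")
    case True
    then have "b @ a = p @ (u # q)" using eq by simp
    then obtain us where us: "b = p @ us \<and> us @ a = u # q \<or> b @ us = p \<and> a = us @ u # q"
      by (auto simp: append_eq_append_conv2)
    have "\<exists>p' q'. a @ b = p' @ u # q' \<and> hd (q' @ p' @ [u]) = hd (q @ p @ [u])"
      using us
    proof
      assume "b = p @ us \<and> us @ a = u # q"
      show ?thesis
      proof (cases us)
        case Nil
        then have "a @ b = [] @ u # (q @ b)" "hd ((q @ b) @ [] @ [u]) = hd (q @ p @ [u])"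
          using \<open>b = p @ us \<and> us @ a = u # q\<close> by auto
        then show ?thesis by blast
      next
        case (Cons u' us')
        then have "a @ b = (a @ p) @ u # us'" "hd (us' @ (a @ p) @ [u]) = hd (q @ p @ [u])"
          using \<open>b = p @ us \<and> us @ a = u # q\<close> by auto
        then show ?thesis by blast
      qed
    next
      assume "b @ us = p \<and> a = us @ u # q"
      then have "a @ b = us @ u # (q @ b)" "hd ((q @ b) @ us @ [u]) = hd (q @ p @ [u])" by auto
      then show ?thesis by blast
    qed
    then show ?thesis using assms unfolding follows_def
      by (metis list.set_intros(1))
  next
    case False
    then show ?thesis using c eq assms unfolding follows_def by auto
  qed
qed

lemma follows_subset: "follows \<sigma> css \<Longrightarrow> set css' \<subseteq> set css \<Longrightarrow> follows \<sigma> css'"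
  unfolding follows_def by blast

lemma follows_exists:
  assumes "distinct (concat css)"
  shows "\<exists>\<sigma>. follows \<sigma> css"
proof -
  define cyc where "cyc u = (SOME c. c \<in> set css \<and> u \<in> set c)" for u
  define \<sigma> where "\<sigma> u = hd (tl (dropWhile (\<lambda>v. v \<noteq> u) (cyc u)) @ cyc u)" for u
  have "\<sigma> u = hd (q @ p @ [u])" if c: "c \<in> set css" "c = p @ u # q" for c p u q
  proof -
    have uniq: "c' = c" if "c' \<in> set css \<and> u \<in> set c'" for c'
    proof (rule ccontr)
      assume "c' \<noteq> c"
      then have "set c' \<inter> set c = {}"
        using assms that c(1) unfolding distinct_concat_iff by blast
      then show False using that c by auto
    qed
    have "cyc u \<in> set css \<and> u \<in> set (cyc u)"
      unfolding cyc_def by (rule someI[of _ c]) (use c in auto)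
    then have cu: "cyc u = c" by (rule uniq)
    have "distinct c" using assms c(1) unfolding distinct_concat_iff by blast
    then have "u \<notin> set p" using c(2) by auto
    then have "dropWhile (\<lambda>v. v \<noteq> u) c = u # q"
      unfolding c(2) by (subst dropWhile_append2) auto
    then show ?thesis unfolding \<sigma>_def cu by (cases q; cases p) (auto simp: c(2))
  qed
  then show ?thesis unfolding follows_def by blast
qed

text \<open>
  Every vertex has a predecessor on its cycle, so \<open>\<sigma>\<close> maps the finite set \<open>V\<close> onto itself. The
  bijectivity lets \<open>\<sigma>\<close> carry large sets to large sets.
\<close>
lemma follows_bij:
  assumes cov: "cycle_cover E V css" and fol: "follows \<sigma> css"
  shows "bij_betw \<sigma> V V"
proof -
  have fin: "finite V" using cov unfolding cycle_cover_def by auto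
  have im: "\<sigma> ` V \<subseteq> V"
  proof
    fix v assume "v \<in> \<sigma> ` V"
    then obtain u where u: "u \<in> V" "v = \<sigma> u" by auto
    then obtain c where c: "c \<in> set css" "u \<in> set c" using cov unfolding cycle_cover_def by auto
    from c(2) obtain p q where pq: "c = p @ u # q" by (auto dest: split_list)
    have "v = hd (q @ p @ [u])" using u fol c pq unfolding follows_def by blast
    then have "v \<in> set c" unfolding pq by (cases q; cases p) auto
    then show "v \<in> V" using c cov unfolding cycle_cover_def by auto
  qed
  have sup: "V \<subseteq> \<sigma> ` V"
  proof
    fix v assume "v \<in> V"
    then obtain c where c: "c \<in> set css" "v \<in> set c" using cov unfolding cycle_cover_def by auto
    from c(2) obtain p q where pq: "c = p @ v # q" by (auto dest: split_list)
    have sub: "set c \<subseteq> V" using c cov unfolding cycle_cover_def by auto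
    show "v \<in> \<sigma> ` V"
    proof (cases "p = []")
      case True
      then have "\<sigma> (last c) = v" using follows_last[OF fol c(1)] pq by auto
      moreover have "last c \<in> V" using sub pq by auto
      ultimately show ?thesis by blast
    next
      case False
      then have "\<sigma> (last p) = v" using follows_inner[OF fol, of p "v # q"] c(1) pq by auto
      moreover have "last p \<in> V" using sub pq False by auto
      ultimately show ?thesis by blast
    qed
  qed
  from finite_surj_inj[OF fin sup] im sup show ?thesis unfolding bij_betw_def by blast
qed

text \<open>
  The exchanges below always open a cycle just after a chosen vertex \<open>u\<close>, which means rotating
  its list until \<open>u\<close> is last.
\<close>
lemma pull_out_cycle:
  assumes fol: "follows \<sigma> css" and cl: "\<And>c. c \<in> set css \<Longrightarrow> cyclic_path E c"
    and u: "u \<in> set (concat css)"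
  obtains c css' where "cyclic_path E c" "last c = u" "hd c = \<sigma> u" "c \<noteq> []"
    "follows \<sigma> (c # css')" "set css' \<subseteq> set css"
    "mset (concat css) = mset c + mset (concat css')" "length css = Suc (length css')"
proof -
  from u obtain c0 where c0: "c0 \<in> set css" "u \<in> set c0" by auto
  from c0(2) obtain p q where pq: "c0 = p @ u # q" by (auto dest: split_list)
  from c0(1) obtain l r where lr: "css = l @ c0 # r" by (auto dest: split_list)
  let ?c = "q @ p @ [u]"
  have "cyclic_path E ((p @ [u]) @ q)" using cl[OF c0(1)] pq by simp
  then have 1: "cyclic_path E ?c" using cyclic_path_rotate by fastforce
  have "follows \<sigma> (((p @ [u]) @ q) # (l @ r))"
    by (rule follows_subset[OF fol]) (auto simp: lr pq)
  then have 2: "follows \<sigma> (?c # (l @ r))" by (rule follows_rotate)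
  have "hd ?c = \<sigma> u" using fol c0 pq unfolding follows_def by metis
  then show thesis using 1 2 by (intro that[of ?c "l @ r"]) (auto simp: lr pq)
qed

lemma split_after:
  assumes "x \<in> set xs"
  obtains A B where "xs = A @ B" "A \<noteq> []" "last A = x"
proof -
  obtain A B where "xs = A @ x # B" using assms by (meson split_list)
  then show thesis by (intro that[of "A @ [x]" B]) auto
qed

lemma set_butlast_last: "A \<noteq> [] \<Longrightarrow> set A = insert (last A) (set (butlast A))"
  by (cases A rule: rev_cases) auto

text \<open>
  The exchange \<open>w \<rightarrow> y \<rightarrow> z \<rightarrow> x \<rightarrow> w\<close> with \<open>w = last P\<close> and \<open>y = last Q\<close> on different cycles. The
  arc from \<open>w\<close> turns \<open>P @ Q\<close> into a path from \<open>hd P\<close> to \<open>y\<close>, which merges two cycles. Continuing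
  to \<open>z\<close> either absorbs a further cycle, and then any \<open>x\<close> is suitable, or, if \<open>z\<close> lies on the path,
  cuts off its part after \<open>z\<close> as a cycle. In the latter case \<open>x\<close> must not precede \<open>z\<close> on the path,
  so that closing the path through \<open>x\<close> absorbs a cycle again.
\<close>
lemma exchange_outside:
  assumes cov: "cycle_cover E V (P # Q # css)" and fol: "follows \<sigma> (P # Q # css)"
    and wy: "E (last P) (hd Q)" and yz: "E (last Q) (\<sigma> z)" and zx: "E z (\<sigma> x)"
    and xs: "E x (hd P)"
    and V: "x \<in> V" "z \<in> V" and ne: "x \<noteq> last P" "z \<noteq> last P" "z \<noteq> last Q" "x \<noteq> z"
    and ord: "\<And>F G. P @ Q = F @ z # G \<Longrightarrow> x \<notin> set F"
  shows "\<exists>css'. cycle_cover E V css' \<and> length css' < length (P # Q # css)"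
proof -
  note cp = cyclic_path_def successively_append_iff
  have cl: "\<And>c. c \<in> set (P # Q # css) \<Longrightarrow> cyclic_path E c"
    using cov unfolding cycle_cover_def by blast
  have P: "P \<noteq> []" "successively E P" and Q: "Q \<noteq> []" "successively E Q"
    using cl[of P] cl[of Q] by (auto simp: cp)
  have succ: "\<sigma> (last A) = hd B"
    if "P @ Q = A @ B" "A \<noteq> []" "B \<noteq> []" "last A \<noteq> last P" for A B
  proof -
    from that(1) obtain us where "P = A @ us \<and> us @ Q = B \<or> P @ us = A \<and> Q = us @ B"
      by (auto simp: append_eq_append_conv2)
    then show ?thesis
    proof
      assume a: "P = A @ us \<and> us @ Q = B"
      then have "us \<noteq> []" using that by auto
      then show ?thesis using a follows_inner[OF fol, of A us] that by auto
    next
      assume a: "P @ us = A \<and> Q = us @ B"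
      then have "us \<noteq> []" using that by auto
      then show ?thesis using a follows_inner[OF fol, of us B] that by auto
    qed
  qed
  have folc: "follows \<sigma> css" by (rule follows_subset[OF fol]) auto
  have clc: "\<And>c. c \<in> set css \<Longrightarrow> cyclic_path E c" using cl by auto
  have PQ: "successively E (P @ Q)" using P Q wy by (auto simp: cp)
  show ?thesis
  proof (cases "x = last Q")
    case True
    have "cyclic_path E (P @ Q)" using P Q wy xs True by (auto simp: cp)
    then have "cycle_cover E V ((P @ Q) # css)"
      by (intro cycle_cover_cong[OF cov]) (use clc in auto)
    then show ?thesis by force
  next
    case xy: False
    show ?thesis
    proof (cases "z \<in> set (P @ Q)")
      case True
      then obtain F G where FG: "P @ Q = F @ G" and Fne: "F \<noteq> []" "last F = z"
        using split_after by metis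
      have xF: "x \<notin> set F"
      proof -
        have "P @ Q = butlast F @ z # G" using FG Fne append_butlast_last_id[of F] by (metis append.assoc append_Cons append_Nil)
        then have "x \<notin> set (butlast F)" by (rule ord)
        moreover have "set F = insert z (set (butlast F))"
          using Fne set_butlast_last by metis
        ultimately show ?thesis using ne by auto
      qed
      have lastPQ: "last (P @ Q) = last Q" using Q by simp
      have Gne: "G \<noteq> []" using FG Fne lastPQ ne by auto
      have lG: "last G = last Q" using Gne lastPQ FG by (metis last_appendR)
      have hF: "hd F = hd P" using FG P Fne by (metis hd_append2)
      have hG: "\<sigma> z = hd G" using succ[OF FG Fne(1) Gne] Fne ne by simp
      have sFG: "successively E F" "successively E G" using PQ unfolding FG by (auto simp: cp)
      have mPQ: "mset P + mset Q = mset F + mset G" using FG by (metis mset_append)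
      show ?thesis
      proof (cases "x \<in> set (P @ Q)")
        case True
        have "x \<in> set G" using True xF unfolding FG by auto
        then obtain G1 G2 where G12: "G = G1 @ G2" "G1 \<noteq> []" "last G1 = x" using split_after by metis
        have G2: "G2 \<noteq> []" using G12 lG xy by auto
        have hG2: "\<sigma> x = hd G2" using succ[of "F @ G1" G2] FG G12 G2 ne by auto
        have "cyclic_path E (F @ G2 @ G1)"
          using Fne hF sFG hG hG2 G12 G2 zx xs yz lG by (auto simp: cp)
        then have "cycle_cover E V ((F @ G2 @ G1) # css)"
          by (intro cycle_cover_cong[OF cov])
             (use clc G12 mPQ in auto)
        then show ?thesis by force
      next
        case False
        then have "x \<in> set (concat css)" using V cov unfolding cycle_cover_def by auto
        then obtain c css' where c: "cyclic_path E c" "last c = x" "hd c = \<sigma> x" "c \<noteq> []"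
          "set css' \<subseteq> set css"
          "mset (concat css) = mset c + mset (concat css')" "length css = Suc (length css')"
          using pull_out_cycle[OF folc clc] by metis
        have "cyclic_path E (F @ c)" "cyclic_path E G"
          using Fne hF sFG hG Gne zx xs yz lG c by (auto simp: cp)
        then have "cycle_cover E V ((F @ c) # G # css')"
          by (intro cycle_cover_cong[OF cov])
             (use clc mPQ c in auto)
        then show ?thesis using c by force
      qed
    next
      case zPQ: False
      then have "z \<in> set (concat css)" using V cov unfolding cycle_cover_def by auto
      then obtain c css' where c: "cyclic_path E c" "last c = z" "hd c = \<sigma> z" "c \<noteq> []"
        "follows \<sigma> (c # css')" "set css' \<subseteq> set css"
        "mset (concat css) = mset c + mset (concat css')" "length css = Suc (length css')"
        using pull_out_cycle[OF folc clc] by metis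
      have sc: "successively E c" using c by (auto simp: cp)
      show ?thesis
      proof (cases "x \<in> set (P @ Q)")
        case True
        then obtain G1 G2 where G12: "P @ Q = G1 @ G2" "G1 \<noteq> []" "last G1 = x"
          using split_after by metis
        have lastPQ: "last (P @ Q) = last Q" using Q by simp
        have G2: "G2 \<noteq> []" using G12 lastPQ xy by auto
        have lG: "last G2 = last Q" using G2 lastPQ G12 by auto
        have hG: "\<sigma> x = hd G2" using succ[of G1 G2] G12 G2 ne by auto
        have hG1: "hd G1 = hd P" using G12 P by (metis hd_append2)
        have s: "successively E G1" "successively E G2"
          using PQ unfolding G12 by (auto simp: cp)
        have "cyclic_path E G1" using s hG1 xs G12 by (simp add: cyclic_path_def)
        moreover have "cyclic_path E (G2 @ c)" using s G2 c sc hG lG yz zx by (auto simp: cp)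
        moreover have "mset P + mset Q = mset G1 + mset G2" using G12 by (metis mset_append)
        ultimately have "cycle_cover E V (G1 # (G2 @ c) # css')"
          by (intro cycle_cover_cong[OF cov]) (use clc c in auto)
        then show ?thesis using c by force
      next
        case xPQ: False
        show ?thesis
        proof (cases "x \<in> set c")
          case True
          then obtain D1 D2 where D: "c = D1 @ D2" "D1 \<noteq> []" "last D1 = x"
            using split_after by metis
          have D2: "D2 \<noteq> []" using D c ne by auto
          have hD: "\<sigma> x = hd D2" using follows_inner[OF c(5), of D1 D2] D D2 by auto
          have "cyclic_path E (P @ Q @ D1)" "cyclic_path E D2"
            using sc P Q wy D D2 c hD yz zx xs by (auto simp: cp)
          then have "cycle_cover E V ((P @ Q @ D1) # D2 # css')"
            by (intro cycle_cover_cong[OF cov]) (use clc c D in auto)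
          then show ?thesis using c by force
        next
          case False
          have "set (concat css) = set c \<union> set (concat css')"
            using c(7) by (metis mset_append mset_eq_setD set_append)
          then have "x \<in> set (concat css')"
            using V cov xPQ False unfolding cycle_cover_def by auto
          moreover have "follows \<sigma> css'" by (rule follows_subset[OF c(5)]) auto
          moreover have clc': "\<And>c. c \<in> set css' \<Longrightarrow> cyclic_path E c" using c(6) clc by auto
          ultimately obtain d css'' where d: "cyclic_path E d" "last d = x" "hd d = \<sigma> x" "d \<noteq> []"
            "set css'' \<subseteq> set css'"
            "mset (concat css') = mset d + mset (concat css'')" "length css' = Suc (length css'')"
            using pull_out_cycle by metis
          have "cyclic_path E (P @ Q @ c @ d)"
            using sc P Q wy c d yz zx xs by (auto simp: cp)
          then have "cycle_cover E V ((P @ Q @ c @ d) # css'')"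
            by (intro cycle_cover_cong[OF cov]) (use clc' c d in auto)
          then show ?thesis using c d by force
        qed
      qed
    qed
  qed
qed


text \<open>
  The exchange \<open>w \<rightarrow> y \<rightarrow> z \<rightarrow> x \<rightarrow> w\<close> with \<open>y = last A\<close>, \<open>z = last B\<close> and \<open>w = last C\<close> on one cycle,
  in this order, and \<open>x\<close> on another: the blocks \<open>B\<close> and \<open>C\<close> trade places, and the cycle of \<open>x\<close> is
  inserted before the path closes.
\<close>
lemma exchange_inside:
  assumes cov: "cycle_cover E V ((A @ B @ C) # css)" and fol: "follows \<sigma> ((A @ B @ C) # css)"
    and ne: "A \<noteq> []" "B \<noteq> []" "C \<noteq> []"
    and wy: "E (last C) (hd B)" and yz: "E (last A) (hd C)" and zx: "E (last B) (\<sigma> x)"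
    and xs: "E x (hd A)" and x: "x \<in> V" "x \<notin> set (A @ B @ C)"
  shows "\<exists>css'. cycle_cover E V css' \<and> length css' < length ((A @ B @ C) # css)"
proof -
  note cp = cyclic_path_def successively_append_iff
  have cl: "\<And>c. c \<in> set ((A @ B @ C) # css) \<Longrightarrow> cyclic_path E c"
    using cov unfolding cycle_cover_def by blast
  have s: "successively E A" "successively E B" "successively E C"
    using cl[of "A @ B @ C"] by (auto simp: cp)
  have folc: "follows \<sigma> css" by (rule follows_subset[OF fol]) auto
  have clc: "\<And>c. c \<in> set css \<Longrightarrow> cyclic_path E c" using cl by auto
  have "x \<in> set (concat css)" using x cov unfolding cycle_cover_def by auto
  then obtain c css' where c: "cyclic_path E c" "last c = x" "hd c = \<sigma> x" "c \<noteq> []"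
    "set css' \<subseteq> set css"
    "mset (concat css) = mset c + mset (concat css')" "length css = Suc (length css')"
    using pull_out_cycle[OF folc clc] by metis
  have "cyclic_path E (A @ C @ B @ c)" using s c ne wy yz zx xs by (auto simp: cp)
  then have "cycle_cover E V ((A @ C @ B @ c) # css')"
    by (intro cycle_cover_cong[OF cov]) (use clc c in auto)
  then show ?thesis using c by force
qed

text \<open>
  For two cycles that are joined by few arcs. The arc to \<open>hd B1\<close> links them to a path from \<open>hd A1\<close>
  to \<open>last B3\<close>. The arc to \<open>hd B2\<close> cuts off the cycle \<open>B2 @ B3\<close>, and the arc to \<open>hd A2\<close> the cycle
  \<open>A2 @ A3 @ B1\<close>; this leaves the path \<open>A1\<close>, to which the arcs to \<open>hd B3\<close> and \<open>hd A3\<close> attach the two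
  cycles again, opened elsewhere. Now the path ends with \<open>A2\<close>, from where the arc to \<open>hd A1\<close> closes
  it. The arcs at \<open>hd A1\<close> and \<open>last B3\<close> stay within their cycles, and the three with both ends free
  come from joinedness.
\<close>
lemma exchange_two_cycles:
  assumes cov: "cycle_cover E V ((A1 @ A2 @ A3) # (B1 @ B2 @ B3) # css)"
    and ne: "A1 \<noteq> []" "A2 \<noteq> []" "A3 \<noteq> []" "B1 \<noteq> []" "B2 \<noteq> []" "B3 \<noteq> []"
    and arcs: "E (last A3) (hd B1)" "E (last B3) (hd B2)" "E (last A2) (hd A1)"
      "E (last B1) (hd A2)" "E (last A1) (hd B3)" "E (last B2) (hd A3)"
  shows "\<exists>css'. cycle_cover E V css' \<and> length css' < length ((A1 @ A2 @ A3) # (B1 @ B2 @ B3) # css)"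
proof -
  note cp = cyclic_path_def successively_append_iff
  have cl: "\<And>c. c \<in> set ((A1 @ A2 @ A3) # (B1 @ B2 @ B3) # css) \<Longrightarrow> cyclic_path E c"
    using cov unfolding cycle_cover_def by blast
  have s: "successively E A1" "successively E A2" "successively E A3"
    "successively E B1" "successively E B2" "successively E B3"
    using cl[of "A1 @ A2 @ A3"] cl[of "B1 @ B2 @ B3"] by (auto simp: cp)
  have "cyclic_path E (A1 @ B3 @ B2 @ A3 @ B1 @ A2)" using s ne arcs by (auto simp: cp)
  then have "cycle_cover E V ((A1 @ B3 @ B2 @ A3 @ B1 @ A2) # css)"
    by (intro cycle_cover_cong[OF cov]) (use cl in auto)
  then show ?thesis by force
qed

section \<open>Choosing vertices by their cyclic position\<close>

text \<open>
  Here \<open>r\<close> stands for the position of a vertex in a list.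
\<close>
lemma lowest_subset:
  fixes r :: "'a \<Rightarrow> nat"
  assumes "finite X" "inj_on r X" "j \<le> card X"
  shows "\<exists>L\<subseteq>X. card L = j \<and> (\<forall>a\<in>L. \<forall>b\<in>X - L. r a < r b)"
  using assms(3)
proof (induction j)
  case 0
  then show ?case by (intro exI[of _ "{}"]) auto
next
  case (Suc j)
  then obtain L where L: "L \<subseteq> X" "card L = j" "\<And>a b. a \<in> L \<Longrightarrow> b \<in> X - L \<Longrightarrow> r a < r b"
    by auto
  have finL: "finite L" using L(1) assms(1) finite_subset by blast
  have "X - L \<noteq> {}" using L Suc.prems finL by (metis Diff_eq_empty_iff card_mono not_less_eq_eq)
  then obtain m where m: "m \<in> X - L" "\<And>b. b \<in> X - L \<Longrightarrow> r m \<le> r b"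
    using ex_min_if_finite[of "r ` (X - L)"] assms(1)
    by (metis (no_types, lifting) arg_min_if_finite(1) arg_min_least finite_Diff)
  have "r a < r b" if "a \<in> insert m L" "b \<in> X - insert m L" for a b
  proof (cases "a = m")
    case True
    have "r m \<noteq> r b" using assms(2) that m(1) unfolding inj_on_def by auto
    then show ?thesis using m(2)[of b] that True by auto
  next
    case False
    then show ?thesis using L(3) that by auto
  qed
  moreover have "card (insert m L) = Suc j" using L finL m by auto
  ultimately show ?case using L(1) m(1) by (intro exI[of _ "insert m L"]) auto
qed

lemma highest_subset:
  fixes r :: "'a \<Rightarrow> nat"
  assumes "finite X" "inj_on r X" "j \<le> card X"
  shows "\<exists>H\<subseteq>X. card H = j \<and> (\<forall>a\<in>X - H. \<forall>b\<in>H. r a < r b)"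
proof -
  obtain L where L: "L \<subseteq> X" "card L = card X - j" "\<forall>a\<in>L. \<forall>b\<in>X - L. r a < r b"
    using lowest_subset[OF assms(1,2), of "card X - j"] by auto
  have "card (X - L) = j"
    using L assms card_Diff_subset[OF finite_subset[OF L(1) assms(1)] L(1)] by auto
  then show ?thesis using L by (intro exI[of _ "X - L"]) auto
qed

definition cyclic_less :: "nat \<Rightarrow> nat \<Rightarrow> nat \<Rightarrow> bool" where
  "cyclic_less a b c \<longleftrightarrow> a < b \<and> b < c \<or> b < c \<and> c < a \<or> c < a \<and> a < b"

text \<open>
  Cut the cyclic order at the median of \<open>X\<close>. One of the two sides contains half of \<open>Y\<close>. If it is
  the upper one, take the top \<open>k\<close> elements of the lower half of \<open>X\<close> and the bottom \<open>k\<close> elements of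
  this half of \<open>Y\<close>: all that remains of the two halves lies cyclically between the latter and the
  former. If it is the lower one, take the bottom \<open>k\<close> elements of the half of \<open>Y\<close> and the top \<open>k\<close>
  elements of the upper half of \<open>X\<close>, with the remains between them.
\<close>
lemma cyclic_blocks:
  fixes r :: "'a \<Rightarrow> nat"
  assumes fin: "finite X" "finite Y" and inj: "inj_on r (X \<union> Y)"
    and s: "s \<le> card X" "s \<le> card Y" "2 * k \<le> s" and k: "k \<ge> 1"
  obtains X' Y' Z where "X' \<subseteq> X" "Y' \<subseteq> Y" "Z \<subseteq> X \<union> Y"
    "card X' = k" "card Y' = k" "s - 2 * k \<le> card Z"
    "\<And>x y z. x \<in> X' \<Longrightarrow> y \<in> Y' \<Longrightarrow> z \<in> Z \<Longrightarrow> cyclic_less (r x) (r y) (r z)"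
proof -
  have injX: "inj_on r A" if "A \<subseteq> X \<union> Y" for A using inj that inj_on_subset by blast
  define h where "h = s div 2"
  have h: "k \<le> h" "2 * h \<le> s" "s \<le> 2 * h + 1" using s by (auto simp: h_def)
  obtain Xl where Xl: "Xl \<subseteq> X" "card Xl = h" "\<And>a b. a \<in> Xl \<Longrightarrow> b \<in> X - Xl \<Longrightarrow> r a < r b"
    using lowest_subset[OF fin(1) injX[of X], of h] s h by auto
  define m where "m = Max (r ` Xl)"
  have finXl: "finite Xl" using Xl(1) fin finite_subset by blast
  have "Xl \<noteq> {}" using Xl h k by auto
  then have "m \<in> r ` Xl" unfolding m_def using finXl by (intro Max_in) auto
  then have mhi: "\<And>b. b \<in> X - Xl \<Longrightarrow> m < r b" using Xl(3) by auto
  have mlo: "\<And>a. a \<in> Xl \<Longrightarrow> r a \<le> m" unfolding m_def using finXl by auto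
  define Y1 Y2 where "Y1 = {y \<in> Y. r y \<le> m}" and "Y2 = {y \<in> Y. m < r y}"
  have fY: "finite Y1" "finite Y2" using fin by (auto simp: Y1_def Y2_def)
  have Y1Y: "Y1 \<subseteq> X \<union> Y" and Y2Y: "Y2 \<subseteq> X \<union> Y" by (auto simp: Y1_def Y2_def)
  have "Y = Y1 \<union> Y2" "Y1 \<inter> Y2 = {}" by (auto simp: Y1_def Y2_def)
  then have cY: "card Y1 + card Y2 = card Y" using card_Un_disjoint[OF fY] by simp
  show thesis
  proof (cases "s - h \<le> card Y1")
    case True
    have kY1: "k \<le> card Y1" using True h by linarith
    have cXh: "card (X - Xl) = card X - h" using card_Diff_subset[OF finXl Xl(1)] Xl(2) by simp
    have kXh: "k \<le> card (X - Xl)" using cXh h s by linarith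
    have fXh: "finite (X - Xl)" and XhY: "X - Xl \<subseteq> X \<union> Y" using fin by auto
    obtain Y' where Y': "Y' \<subseteq> Y1" "card Y' = k" "\<And>a b. a \<in> Y' \<Longrightarrow> b \<in> Y1 - Y' \<Longrightarrow> r a < r b"
      using lowest_subset[OF fY(1) injX[OF Y1Y] kY1] by metis
    obtain X' where X': "X' \<subseteq> X - Xl" "card X' = k"
        "\<And>a b. a \<in> X - Xl - X' \<Longrightarrow> b \<in> X' \<Longrightarrow> r a < r b"
      using highest_subset[OF fXh injX[OF XhY] kXh] by metis
    define Z where "Z = (Y1 - Y') \<union> (X - Xl - X')"
    have fs: "finite Y'" "finite X'" using Y'(1) X'(1) fY fin by (auto intro: finite_subset)
    have "card (Y1 - Y') = card Y1 - k" "card (X - Xl - X') = card X - h - k"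
      using card_Diff_subset[OF fs(1) Y'(1)] card_Diff_subset[OF fs(2) X'(1)] Y' X' cXh by auto
    moreover have "(Y1 - Y') \<inter> (X - Xl - X') = {}" using mhi by (force simp: Y1_def)
    ultimately have "card Z = (card Y1 - k) + (card X - h - k)"
      unfolding Z_def using fY fin by (subst card_Un_disjoint) auto
    then have "s - 2 * k \<le> card Z" using True s h kY1 kXh cXh by linarith
    moreover have "cyclic_less (r x) (r y) (r z)" if "x \<in> X'" "y \<in> Y'" "z \<in> Z" for x y z
    proof -
      have "r y \<le> m" "m < r x" using that Y' X' mhi by (auto simp: Y1_def)
      moreover have "r y < r z \<and> r z < r x"
      proof (cases "z \<in> Y1 - Y'")
        case True
        then have "r z \<le> m" by (auto simp: Y1_def)
        then show ?thesis using Y'(3)[of y z] True that \<open>m < r x\<close> by auto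
      next
        case False
        then have z: "z \<in> X - Xl - X'" using that Z_def by auto
        then have "m < r z" using mhi by auto
        then show ?thesis using X'(3)[of z x] z that \<open>r y \<le> m\<close> by auto
      qed
      ultimately show ?thesis by (auto simp: cyclic_less_def)
    qed
    ultimately show thesis using Y' X'
      by (intro that[of X' Y' Z]) (auto simp: Z_def Y1_def)
  next
    case False
    then have cY2: "h + 1 \<le> card Y2" using cY s h by linarith
    have kY2: "k \<le> card Y2" and kXl: "k \<le> card Xl" using cY2 h Xl(2) by linarith+
    have XlY: "Xl \<subseteq> X \<union> Y" using Xl(1) by auto
    obtain Y' where Y': "Y' \<subseteq> Y2" "card Y' = k" "\<And>a b. a \<in> Y' \<Longrightarrow> b \<in> Y2 - Y' \<Longrightarrow> r a < r b"
      using lowest_subset[OF fY(2) injX[OF Y2Y] kY2] by metis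
    obtain X' where X': "X' \<subseteq> Xl" "card X' = k" "\<And>a b. a \<in> Xl - X' \<Longrightarrow> b \<in> X' \<Longrightarrow> r a < r b"
      using highest_subset[OF finXl injX[OF XlY] kXl] by metis
    define Z where "Z = (Y2 - Y') \<union> (Xl - X')"
    have fs: "finite Y'" "finite X'" using Y'(1) X'(1) fY finXl by (auto intro: finite_subset)
    have "card (Y2 - Y') = card Y2 - k" "card (Xl - X') = h - k"
      using card_Diff_subset[OF fs(1) Y'(1)] card_Diff_subset[OF fs(2) X'(1)] Y' X' Xl by auto
    moreover have "(Y2 - Y') \<inter> (Xl - X') = {}" using mlo by (force simp: Y2_def)
    ultimately have "card Z = (card Y2 - k) + (h - k)"
      unfolding Z_def using fY finXl by (subst card_Un_disjoint) auto
    then have "s - 2 * k \<le> card Z" using cY2 s h by linarith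
    moreover have "cyclic_less (r x) (r y) (r z)" if "x \<in> X'" "y \<in> Y'" "z \<in> Z" for x y z
    proof -
      have xy: "r x \<le> m" "m < r y" using that Y' X' mlo by (auto simp: Y2_def)
      show ?thesis
      proof (cases "z \<in> Y2 - Y'")
        case True
        then show ?thesis using Y'(3)[of y z] that xy by (auto simp: cyclic_less_def)
      next
        case False
        then have z: "z \<in> Xl - X'" using that Z_def by auto
        then show ?thesis using X'(3)[of z x] z that xy by (auto simp: cyclic_less_def)
      qed
    qed
    ultimately show thesis using Y' X' Xl
      by (intro that[of X' Y' Z]) (auto simp: Z_def Y2_def)
  qed
qed

definition pos :: "'a list \<Rightarrow> 'a \<Rightarrow> nat" where
  "pos xs u = length (takeWhile (\<lambda>v. v \<noteq> u) xs)"

lemma pos_append_Cons: "u \<notin> set A \<Longrightarrow> pos (A @ u # B) u = length A"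
  unfolding pos_def by (subst takeWhile_append2) auto

lemma pos_less:
  assumes "distinct (A @ B)" "u \<in> set A" "v \<in> set B"
  shows "pos (A @ B) u < pos (A @ B) v"
proof -
  obtain A1 A2 where A: "A = A1 @ u # A2" using assms by (meson split_list)
  obtain B1 B2 where B: "B = B1 @ v # B2" using assms by (meson split_list)
  have "pos (A @ B) u = length A1"
    using pos_append_Cons[of u A1 "A2 @ B"] assms unfolding A by auto
  moreover have "pos (A @ B) v = length (A @ B1)"
    using pos_append_Cons[of v "A @ B1" B2] assms unfolding B by auto
  ultimately show ?thesis unfolding A by simp
qed

lemma nth_pos: "u \<in> set xs \<Longrightarrow> xs ! pos xs u = u"
  unfolding pos_def by (induction xs) auto

lemma inj_on_pos: "inj_on (pos xs) (set xs)"
  by (metis inj_onI nth_pos)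

lemma split_by_pos:
  assumes "distinct P" "u \<in> set P" "v \<in> set P" "pos P u < pos P v"
  obtains A B C where "P = A @ B @ C" "A \<noteq> []" "B \<noteq> []" "last A = u" "last B = v"
proof -
  obtain A R where A: "P = A @ R" "A \<noteq> []" "last A = u" using assms(2) split_after by metis
  have "v \<notin> set A"
  proof
    assume v: "v \<in> set A"
    have "A = butlast A @ [u]" using A append_butlast_last_id[of A] by simp
    then have eq: "P = butlast A @ (u # R)" using A(1) by (metis append.assoc append_Cons append_Nil)
    have "v \<noteq> u" using assms(4) by auto
    then have "v \<in> set (butlast A)" using v A set_butlast_last[of A] by auto
    then have "pos P v < pos P u" using pos_less[of "butlast A" "u # R" v u] eq assms(1) by auto
    then show False using assms(4) by simp
  qed
  then have "v \<in> set R" using A assms(3) by auto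
  then obtain B C where "R = B @ C" "B \<noteq> []" "last B = v" using split_after by metis
  then show thesis using A that by blast
qed

lemma not_cyclic_less: "a < b \<Longrightarrow> b < c \<Longrightarrow> \<not> cyclic_less a c b \<and> \<not> cyclic_less c b a \<and> \<not> cyclic_less b a c"
  by (auto simp: cyclic_less_def)

text \<open>
  If \<open>x\<close>, \<open>y\<close> and \<open>z\<close> avoid \<open>P\<close>, list the vertices of the other cycles one cycle after the other. It
  is enough that \<open>x\<close>, \<open>y\<close>, \<open>z\<close> occur in this cyclic order in the resulting list: if \<open>y\<close> and \<open>z\<close> share
  a cycle, then \<open>x\<close> is not between \<open>y\<close> and \<open>z\<close>, and if they do not, the order is irrelevant. So one
  condition handles vertices of different cycles at once.
\<close>
lemma exchange_outside_ordered:
  assumes cov: "cycle_cover E V (P # css)" and fol: "follows \<sigma> (P # css)"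
    and y: "y \<in> V" "y \<notin> set P" and V: "x \<in> V" "z \<in> V"
    and arcs: "E (last P) (\<sigma> y)" "E y (\<sigma> z)" "E z (\<sigma> x)" "E x (hd P)"
    and ne: "x \<noteq> last P" "z \<noteq> last P" "z \<noteq> y" "x \<noteq> z"
    and ord: "x \<notin> set P \<and> z \<in> set P \<or> x \<in> set P \<and> z \<in> set P \<and> pos P z < pos P x \<or>
      x \<notin> set P \<and> z \<notin> set P \<and>
      cyclic_less (pos (concat css) x) (pos (concat css) y) (pos (concat css) z)"
  shows "\<exists>css'. cycle_cover E V css' \<and> length css' < length (P # css)"
proof -
  have dist: "distinct (concat (P # css))" using cov unfolding cycle_cover_def by blast
  have "y \<in> set (concat css)" using y cov unfolding cycle_cover_def by auto
  then obtain c0 where c0: "c0 \<in> set css" "y \<in> set c0" by auto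
  from c0(2) obtain p q where pq: "c0 = p @ y # q" by (auto dest: split_list)
  from c0(1) obtain l r where lr: "css = l @ c0 # r" by (auto dest: split_list)
  let ?Q = "q @ p @ [y]"
  have cl: "\<And>c. c \<in> set (P # css) \<Longrightarrow> cyclic_path E c"
    using cov unfolding cycle_cover_def by blast
  then have "cyclic_path E ((p @ [y]) @ q)" using c0 pq by simp
  then have "cyclic_path E ?Q" using cyclic_path_rotate by fastforce
  then have cov': "cycle_cover E V (P # ?Q # l @ r)"
    by (intro cycle_cover_cong[OF cov]) (use cl lr pq in auto)
  have "follows \<sigma> (((p @ [y]) @ q) # P # (l @ r))"
    by (rule follows_subset[OF fol]) (auto simp: lr pq)
  then have "follows \<sigma> (?Q # P # l @ r)" using follows_rotate by fastforce
  then have fol': "follows \<sigma> (P # ?Q # l @ r)" by (rule follows_subset) auto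
  have hQ: "hd ?Q = \<sigma> y" using fol c0 pq unfolding follows_def by (metis list.set_intros(2))
  have dPQ: "distinct (P @ ?Q)" using dist by (auto simp: lr pq)
  have dL: "distinct (concat css)" using dist by simp
  have L: "concat css = concat l @ p @ y # q @ concat r" by (simp add: lr pq)
  have less: "pos (concat css) u < pos (concat css) v"
    if "concat css = A @ B" "u \<in> set A" "v \<in> set B" for A B u v
    using pos_less[of A B u v] that dL by simp
  have "x \<notin> set F" if eq: "P @ ?Q = F @ z # G" for F G
  proof
    assume xF: "x \<in> set F"
    have dF: "distinct (F @ z # G)" using dPQ eq by simp
    from eq obtain us where us: "P = F @ us \<and> us @ ?Q = z # G \<or> P @ us = F \<and> ?Q = us @ z # G"
      by (auto simp: append_eq_append_conv2)
    show False
    proof (cases "z \<in> set P")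
      case True
      then have a: "P = F @ us" using us dF by auto
      then have "z \<in> set us" using True dF by auto
      then have "pos P x < pos P z" "x \<in> set P"
        using pos_less[of F us x z] a xF dPQ by auto
      then show False using ord True by auto
    next
      case False
      then have "us = [] \<or> (P @ us = F \<and> ?Q = us @ z # G)" using us by (cases us) auto
      then have b: "P @ us = F" "?Q = us @ z # G" using us by auto
      have x: "x \<notin> set P" and
        cyc: "cyclic_less (pos (concat css) x) (pos (concat css) y) (pos (concat css) z)"
        using ord False by auto
      then have xus: "x \<in> set us" using xF b by auto
      from b(2) obtain vs where vs: "q = us @ vs \<and> vs @ p @ [y] = z # G \<or> q @ vs = us \<and> p @ [y] = vs @ z # G"
        by (auto simp: append_eq_append_conv2)
      then have "(\<exists>vs'. q = us @ z # vs') \<or> (\<exists>vs. q @ vs = us \<and> p @ [y] = vs @ z # G)"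
        by (cases vs) auto
      then show False
      proof
        assume "\<exists>vs'. q = us @ z # vs'"
        then obtain vs' where v: "q = us @ z # vs'" by auto
        have "pos (concat css) y < pos (concat css) x"
          using less[of "concat l @ p @ [y]" "q @ concat r"] L xus v by auto
        moreover have "pos (concat css) x < pos (concat css) z"
          using less[of "concat l @ p @ y # us" "z # vs' @ concat r"] L xus v by auto
        ultimately show False using cyc not_cyclic_less by blast
      next
        assume "\<exists>vs. q @ vs = us \<and> p @ [y] = vs @ z # G"
        then obtain vs where v: "q @ vs = us" "p @ [y] = vs @ z # G" by auto
        have "G \<noteq> []" using v(2) ne by auto
        then obtain G' where G: "p = vs @ z # G'" using v(2)
          by (cases G rule: rev_cases) auto
        have zy: "pos (concat css) z < pos (concat css) y"
          using less[of "concat l @ p" "y # q @ concat r"] L G by auto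
        show False
        proof (cases "x \<in> set q")
          case True
          have "pos (concat css) y < pos (concat css) x"
            using less[of "concat l @ p @ [y]" "q @ concat r"] L True by auto
          then show False using zy cyc not_cyclic_less by blast
        next
          case False
          then have "x \<in> set vs" using xus v by auto
          then have "pos (concat css) x < pos (concat css) z"
            using less[of "concat l @ vs" "z # G' @ y # q @ concat r"] L G by auto
          then show False using zy cyc not_cyclic_less by blast
        qed
      qed
    qed
  qed
  then have "\<exists>css'. cycle_cover E V css' \<and> length css' < length (P # ?Q # l @ r)"
    using exchange_outside[OF cov' fol', of z x] arcs V ne hQ by fastforce
  then show ?thesis by (simp add: lr)
qed

section \<open>Hamilton cycles in joined digraphs of large minimum degree\<close>

text \<open>
  As \<open>E\<close> is reflexive, \<open>joined\<close> has content only for disjoint sets, and the degrees count the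
  virtual loop.
\<close>
locale joined_digraph =
  fixes V :: "'a set" and E :: "'a \<Rightarrow> 'a \<Rightarrow> bool" and k :: nat
  assumes finite_V: "finite V"
    and reflexive: "v \<in> V \<Longrightarrow> E v v"
    and k_pos: "1 \<le> k"
    and out_large: "v \<in> V \<Longrightarrow> 4 * k + 1 \<le> card {u \<in> V. E v u}"
    and in_large: "v \<in> V \<Longrightarrow> 4 * k + 1 \<le> card {u \<in> V. E u v}"
    and joined: "S \<subseteq> V \<Longrightarrow> T \<subseteq> V \<Longrightarrow> k \<le> card S \<Longrightarrow> k \<le> card T \<Longrightarrow> \<exists>a\<in>S. \<exists>b\<in>T. E a b"
begin

lemma few_unreached:
  assumes \<sigma>: "bij_betw \<sigma> V V" and "Y \<subseteq> V" "k \<le> card Y" "Z \<subseteq> V"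
  shows "card {z \<in> Z. \<forall>y\<in>Y. \<not> E y (\<sigma> z)} < k"
proof (rule ccontr)
  let ?N = "{z \<in> Z. \<forall>y\<in>Y. \<not> E y (\<sigma> z)}"
  assume "\<not> card ?N < k"
  moreover have "inj_on \<sigma> ?N"
    by (rule inj_on_subset[OF bij_betw_imp_inj_on[OF \<sigma>]]) (use assms(4) in auto)
  ultimately have "k \<le> card (\<sigma> ` ?N)" by (simp add: card_image)
  moreover have "\<sigma> ` ?N \<subseteq> V" using \<sigma> assms(4) by (auto simp: bij_betw_def)
  ultimately show False using joined[of Y "\<sigma> ` ?N"] assms(2,3) by auto
qed

lemma few_unreaching:
  assumes \<sigma>: "bij_betw \<sigma> V V" and "X \<subseteq> V" "k \<le> card X" "Z \<subseteq> V"
  shows "card {z \<in> Z. \<forall>x\<in>X. \<not> E z (\<sigma> x)} < k"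
proof (rule ccontr)
  let ?N = "{z \<in> Z. \<forall>x\<in>X. \<not> E z (\<sigma> x)}"
  assume "\<not> card ?N < k"
  moreover have "inj_on \<sigma> X" using \<sigma> assms(2) by (auto simp: bij_betw_def inj_on_def)
  then have "k \<le> card (\<sigma> ` X)" using assms(3) by (simp add: card_image)
  moreover have "\<sigma> ` X \<subseteq> V" using \<sigma> assms(2) by (auto simp: bij_betw_def)
  ultimately show False using joined[of ?N "\<sigma> ` X"] assms(4) by auto
qed

text \<open>
  Fewer than \<open>k\<close> vertices of \<open>Z\<close> have a successor without in-neighbour in \<open>Y\<close>, and fewer than \<open>k\<close>
  have no arc to a successor of a vertex of \<open>X\<close>.
\<close>
lemma connect_via_one:
  assumes \<sigma>: "bij_betw \<sigma> V V" and X: "X \<subseteq> V" "k \<le> card X" and Y: "Y \<subseteq> V" "k \<le> card Y"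
    and Z: "Z \<subseteq> V" "2 * k \<le> card Z"
  obtains x y z where "x \<in> X" "y \<in> Y" "z \<in> Z" "E y (\<sigma> z)" "E z (\<sigma> x)"
proof -
  let ?A = "{z \<in> Z. \<forall>y\<in>Y. \<not> E y (\<sigma> z)}" and ?B = "{z \<in> Z. \<forall>x\<in>X. \<not> E z (\<sigma> x)}"
  have fin: "finite Z" using Z(1) finite_V finite_subset by blast
  have "card (?A \<union> ?B) < 2 * k"
    using card_Un_le[of ?A ?B] few_unreached[OF \<sigma> Y Z(1)] few_unreaching[OF \<sigma> X Z(1)] by linarith
  then have "\<not> Z \<subseteq> ?A \<union> ?B" using Z(2) card_mono[of "?A \<union> ?B" Z] fin by fastforce
  then show thesis using that by blast
qed

lemma connect_via_two:
  assumes \<sigma>: "bij_betw \<sigma> V V" and X: "X \<subseteq> V" "k \<le> card X" and Y: "Y \<subseteq> V" "k \<le> card Y"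
    and Z: "Z \<subseteq> V" "2 * k \<le> card Z" and W: "W \<subseteq> V" "2 * k \<le> card W"
  obtains x y z w where "x \<in> X" "y \<in> Y" "z \<in> Z" "w \<in> W" "E y (\<sigma> z)" "E z (\<sigma> w)" "E w (\<sigma> x)"
proof -
  let ?A = "{z \<in> Z. \<forall>y\<in>Y. \<not> E y (\<sigma> z)}" and ?Z = "{z \<in> Z. \<exists>y\<in>Y. E y (\<sigma> z)}"
  have fin: "finite Z" using Z(1) finite_V finite_subset by blast
  have "card Z = card (?A \<union> ?Z)" by (rule arg_cong[where f = card]) auto
  then have "k \<le> card ?Z"
    using card_Un_le[of ?A ?Z] few_unreached[OF \<sigma> Y Z(1)] Z(2) by linarith
  then obtain x z w where "x \<in> X" "z \<in> ?Z" "w \<in> W" "E z (\<sigma> w)" "E w (\<sigma> x)"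
    using connect_via_one[OF \<sigma> X, of ?Z W] Z W by blast
  then show thesis using that by blast
qed

definition minimal_cover :: "'a list list \<Rightarrow> bool" where
  "minimal_cover css \<longleftrightarrow> cycle_cover E V css \<and> (\<forall>css'. cycle_cover E V css' \<longrightarrow> length css \<le> length css')"

lemma card_successor_preimage:
  assumes "bij_betw \<sigma> V V" "w \<in> V"
  shows "4 * k + 1 \<le> card {y \<in> V. E w (\<sigma> y)}"
proof -
  have "{u \<in> V. E w u} = \<sigma> ` {y \<in> V. E w (\<sigma> y)}" using assms(1) by (auto simp: bij_betw_def)
  moreover have "inj_on \<sigma> {y \<in> V. E w (\<sigma> y)}" using assms(1) by (auto simp: bij_betw_def inj_on_def)
  ultimately show ?thesis using out_large[OF assms(2)] by (metis card_image)
qed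

text \<open>
  The counting behind the choice of \<open>4 * k + 1\<close>. Let \<open>X\<close> and \<open>Y\<close> be the sets of possible \<open>x\<close> and
  \<open>y\<close> for \<open>w = last P\<close>. If \<open>P\<close> has at most \<open>2 * k\<close> vertices, then at least \<open>s = 4 * k + 1 - card P\<close>
  elements of either set are outside \<open>P\<close>, and \<open>cyclic_blocks\<close> yields \<open>s - 2 * k\<close> positions for \<open>z\<close>
  outside \<open>P\<close>; any vertex of \<open>P\<close> other than \<open>w\<close> is also suitable, which makes \<open>2 * k\<close> in total. If \<open>P\<close>
  is longer, its vertices are enough for \<open>z\<close> as soon as \<open>k\<close> elements of both \<open>X\<close> and \<open>Y\<close> are outside.
  If this happens for only one of the two sets, then the other has more than \<open>3 * k\<close> elements on
  \<open>P\<close>, and \<open>k\<close> extreme ones leave \<open>2 * k\<close> on the right side for \<open>z\<close>.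
\<close>
lemma few_neighbours_outside:
  assumes min: "minimal_cover (P # css)" and fol: "follows \<sigma> (P # css)"
  shows "card ({x \<in> V. E x (hd P)} - set P) < k \<and> card ({y \<in> V. E (last P) (\<sigma> y)} - set P) < k"
proof -
  have cov: "cycle_cover E V (P # css)" using min unfolding minimal_cover_def by blast
  have noshort: "\<not> (\<exists>css'. cycle_cover E V css' \<and> length css' < length (P # css))"
    using min unfolding minimal_cover_def by (meson not_le)
  have \<sigma>: "bij_betw \<sigma> V V" by (rule follows_bij[OF cov fol])
  have cl: "\<And>c. c \<in> set (P # css) \<Longrightarrow> cyclic_path E c"
    using cov unfolding cycle_cover_def by blast
  have P: "P \<noteq> []" "successively E P" "distinct P" "set P \<subseteq> V"
    using cov unfolding cycle_cover_def cyclic_path_def by auto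
  have inP: "last P \<in> set P" "hd P \<in> set P" using P by auto
  have L: "distinct (concat css)" "set (concat css) = V - set P"
    using cov unfolding cycle_cover_def by auto
  have inV: "last P \<in> V" "hd P \<in> V" using inP P by blast+
  define X where "X = {x \<in> V. E x (hd P)}"
  define Y where "Y = {y \<in> V. E (last P) (\<sigma> y)}"
  have cX: "4 * k + 1 \<le> card X" unfolding X_def by (rule in_large[OF inV(2)])
  have cY: "4 * k + 1 \<le> card Y"
    unfolding Y_def by (rule card_successor_preimage[OF \<sigma> inV(1)])
  have fXY: "finite X" "finite Y" unfolding X_def Y_def using finite_V by auto
  have split: "card S = card (S \<inter> set P) + card (S - set P)" if "finite S" for S
    using that by (metis card_Int_Diff)
  have cP1: "card (set P - {last P}) = card (set P) - 1" using inP by simp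
  \<comment> \<open>Joinedness supplies the middle arcs; it remains to name sets of candidates all of whose
    triples are in a good position.\<close>
  have outside: False
    if X': "X' \<subseteq> X" "k \<le> card X'" and Y': "Y' \<subseteq> Y - set P" "k \<le> card Y'"
      and Z': "Z \<subseteq> V - {last P}" "2 * k \<le> card Z" and xl: "last P \<notin> X'"
      and ord: "\<And>x y z. x \<in> X' \<Longrightarrow> y \<in> Y' \<Longrightarrow> z \<in> Z \<Longrightarrow> z \<noteq> y \<and> x \<noteq> z \<and>
        (x \<notin> set P \<and> z \<in> set P \<or> x \<in> set P \<and> z \<in> set P \<and> pos P z < pos P x \<or>
        x \<notin> set P \<and> z \<notin> set P \<and>
        cyclic_less (pos (concat css) x) (pos (concat css) y) (pos (concat css) z))"
    for X' Y' Z
  proof -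
    have sub: "X' \<subseteq> V" "Y' \<subseteq> V" "Z \<subseteq> V" using X' Y' Z' by (auto simp: X_def Y_def)
    obtain x y z where xyz: "x \<in> X'" "y \<in> Y'" "z \<in> Z" "E y (\<sigma> z)" "E z (\<sigma> x)"
      using connect_via_one[OF \<sigma> sub(1) X'(2) sub(2) Y'(2) sub(3) Z'(2)] by metis
    have "\<exists>css'. cycle_cover E V css' \<and> length css' < length (P # css)"
    proof (rule exchange_outside_ordered[OF cov fol])
      show "z \<noteq> y" "x \<noteq> z" using ord xyz by auto
    qed (use xyz ord X' Y' Z' sub xl in \<open>auto simp: X_def Y_def\<close>)
    then show False using noshort by blast
  qed
  define Xo Yo where "Xo = X - set P" and "Yo = Y - set P"
  have fo: "finite Xo" "finite Yo" unfolding Xo_def Yo_def using fXY by auto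
  \<comment> \<open>A short \<open>P\<close>: find \<open>x\<close>, \<open>y\<close> and part of the \<open>z\<close> on the other cycles.\<close>
  have small: "2 * k + 1 \<le> card (set P)"
  proof (rule ccontr)
    assume "\<not> 2 * k + 1 \<le> card (set P)"
    define s where "s = 4 * k + 1 - card (set P)"
    have c: "card (set P) \<le> 2 * k" "1 \<le> card (set P)"
      using \<open>\<not> 2 * k + 1 \<le> card (set P)\<close> P by (auto simp: Suc_le_eq card_gt_0_iff)
    have cI: "card (X \<inter> set P) \<le> card (set P)" "card (Y \<inter> set P) \<le> card (set P)"
      by (auto intro: card_mono)
    have s: "s \<le> card Xo" "s \<le> card Yo" "2 * k \<le> s"
      using split[OF fXY(1)] split[OF fXY(2)] cX cY cI c unfolding s_def Xo_def Yo_def by linarith+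
    have "Xo \<union> Yo \<subseteq> set (concat css)" using L by (auto simp: Xo_def Yo_def X_def Y_def)
    then have "inj_on (pos (concat css)) (Xo \<union> Yo)" using inj_on_pos inj_on_subset by blast
    then obtain X' Y' Z where XYZ: "X' \<subseteq> Xo" "Y' \<subseteq> Yo" "Z \<subseteq> Xo \<union> Yo"
      "card X' = k" "card Y' = k" "s - 2 * k \<le> card Z"
      "\<And>x y z. x \<in> X' \<Longrightarrow> y \<in> Y' \<Longrightarrow> z \<in> Z \<Longrightarrow>
        cyclic_less (pos (concat css) x) (pos (concat css) y) (pos (concat css) z)"
      using cyclic_blocks[OF fo _ s k_pos, of "pos (concat css)"] by metis
    let ?Z = "Z \<union> (set P - {last P})"
    have fZ: "finite Z" using XYZ(3) fo finite_subset by blast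
    have ZP: "Z \<inter> set P = {}" using XYZ(3) by (auto simp: Xo_def Yo_def)
    then have "card ?Z = card Z + (card (set P) - 1)"
      using fZ cP1 by (subst card_Un_disjoint) auto
    then have cZ: "2 * k \<le> card ?Z" using XYZ(6) c unfolding s_def by linarith
    show False
    proof (rule outside[of X' Y' ?Z])
      show "X' \<subseteq> X" "k \<le> card X'" "Y' \<subseteq> Y - set P" "k \<le> card Y'" "2 * k \<le> card ?Z"
        using XYZ cZ by (auto simp: Xo_def Yo_def)
      show "last P \<notin> X'" using XYZ inP by (auto simp: Xo_def)
      show "?Z \<subseteq> V - {last P}"
        using P XYZ ZP inP by (auto simp: Xo_def Yo_def X_def Y_def)
    next
      fix x y z assume xyz: "x \<in> X'" "y \<in> Y'" "z \<in> ?Z"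
      have o: "x \<notin> set P" "y \<notin> set P" using xyz XYZ by (auto simp: Xo_def Yo_def)
      show "z \<noteq> y \<and> x \<noteq> z \<and>
        (x \<notin> set P \<and> z \<in> set P \<or> x \<in> set P \<and> z \<in> set P \<and> pos P z < pos P x \<or>
        x \<notin> set P \<and> z \<notin> set P \<and>
        cyclic_less (pos (concat css) x) (pos (concat css) y) (pos (concat css) z))"
      proof (cases "z \<in> set P")
        case True
        then show ?thesis using o by auto
      next
        case False
        then have "z \<in> Z" using xyz by auto
        then have "cyclic_less (pos (concat css) x) (pos (concat css) y) (pos (concat css) z)"
          using XYZ(7) xyz by blast
        then show ?thesis using o False by (auto simp: cyclic_less_def)
      qed
    qed
  qed
  have not_both: "\<not> (k \<le> card Xo \<and> k \<le> card Yo)"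
  proof
    assume "k \<le> card Xo \<and> k \<le> card Yo"
    then show False
      using outside[of Xo Yo "set P - {last P}"] cP1 small P inP
      by (force simp: Xo_def Yo_def)
  qed
  have injP: "inj_on (pos P) S" if "S \<subseteq> set P" for S using inj_on_pos that inj_on_subset by blast
  have Yo: "card Yo < k"
  proof (rule ccontr)
    assume y: "\<not> card Yo < k"
    define S where "S = X \<inter> set P - {last P}"
    have fS: "finite S" by (simp add: S_def)
    have "card (X \<inter> set P) - 1 \<le> card S" unfolding S_def by (simp add: card_Diff_singleton_if)
    then have cS: "3 * k + 1 \<le> card S" using y not_both split[OF fXY(1)] cX unfolding Xo_def by linarith
    then obtain H where H: "H \<subseteq> S" "card H = k" "\<And>a b. a \<in> S - H \<Longrightarrow> b \<in> H \<Longrightarrow> pos P a < pos P b"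
      using highest_subset[OF fS injP[of S], of k] by (auto simp: S_def)
    have "card (S - H) = card S - k" using H fS by (metis card_Diff_subset finite_subset)
    then have "2 * k \<le> card (S - H)" using cS by linarith
    then show False
      using outside[of H Yo "S - H"] H y P by (force simp: Yo_def S_def)
  qed
  have Xo: "card Xo < k"
  proof (rule ccontr)
    assume x: "\<not> card Xo < k"
    define S where "S = Y \<inter> set P - {last P}"
    have fS: "finite S" by (simp add: S_def)
    have "card (Y \<inter> set P) - 1 \<le> card S" unfolding S_def by (simp add: card_Diff_singleton_if)
    then have cS: "3 * k + 1 \<le> card S" using x Yo split[OF fXY(2)] cY unfolding Yo_def by linarith
    then obtain H where H: "H \<subseteq> S" "card H = k" "\<And>a b. a \<in> H \<Longrightarrow> b \<in> S - H \<Longrightarrow> pos P a < pos P b"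
      using lowest_subset[OF fS injP[of S], of k] by (auto simp: S_def)
    have "card (S - H) = card S - k" using H fS by (metis card_Diff_subset finite_subset)
    then have cSH: "2 * k \<le> card (S - H)" using cS by linarith
    have sub: "Xo \<subseteq> V" "H \<subseteq> V" "S - H \<subseteq> V" using H P by (auto simp: Xo_def X_def S_def)
    obtain x y z where xyz: "x \<in> Xo" "y \<in> H" "z \<in> S - H" "E y (\<sigma> z)" "E z (\<sigma> x)"
      using connect_via_one[OF \<sigma> sub(1) _ sub(2) _ sub(3) cSH] x H(2) by (metis le_refl not_le)
    have yzP: "y \<in> set P" "z \<in> set P" "z \<noteq> last P" "y \<in> Y" using xyz H by (auto simp: S_def)
    obtain A B C where ABC: "P = A @ B @ C" "A \<noteq> []" "B \<noteq> []" "last A = y" "last B = z"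
      using split_by_pos[OF P(3) yzP(1,2) H(3)[OF xyz(2,3)]] by metis
    have C: "C \<noteq> []" using ABC yzP by auto
    have "\<sigma> y = hd B" using follows_inner[OF fol, of A "B @ C"] ABC by auto
    moreover have "\<sigma> z = hd C" using follows_inner[OF fol, of "A @ B" C] ABC C by auto
    ultimately have "\<exists>css'. cycle_cover E V css' \<and> length css' < length ((A @ B @ C) # css)"
      using xyz ABC C yzP
      by (intro exchange_inside[where x = x, OF cov[unfolded ABC(1)] fol[unfolded ABC(1)]])
         (auto simp: Xo_def X_def Y_def)
    then show False using noshort ABC by simp
  qed
  show ?thesis using Xo Yo unfolding Xo_def Yo_def X_def Y_def by simp
qed

text \<open>
  By \<open>few_neighbours_outside\<close>, applied to every rotation of every cycle, two cycles of a minimal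
  cover have at least \<open>k\<close> vertices each, so some arc leads from one to a successor on the other, and
  the end vertices of the resulting path have more than \<open>3 * k\<close> neighbours in their own cycles.
  This leaves \<open>k\<close> candidates for each of the two outer vertices of \<open>exchange_two_cycles\<close> and \<open>2 * k\<close>
  for each of the two inner ones.
\<close>
lemma minimal_cover_single:
  assumes min: "minimal_cover css0"
  shows "length css0 \<le> 1"
proof (rule ccontr)
  assume "\<not> length css0 \<le> 1"
  then obtain P0 Q0 css where css0: "css0 = P0 # Q0 # css"
    by (metis One_nat_def le_Suc_eq length_Cons list.exhaust list.size(3) zero_le)
  have cov0: "cycle_cover E V (P0 # Q0 # css)" using min css0 unfolding minimal_cover_def by blast
  have noshort: "length (P0 # Q0 # css) \<le> length css'" if "cycle_cover E V css'" for css'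
    using min that css0 unfolding minimal_cover_def by (meson not_le)
  have "distinct (concat (P0 # Q0 # css))" using cov0 unfolding cycle_cover_def by blast
  from follows_exists[OF this] obtain \<sigma> where fol0: "follows \<sigma> (P0 # Q0 # css)" by blast
  have \<sigma>: "bij_betw \<sigma> V V" by (rule follows_bij[OF cov0 fol0])
  have cl: "\<And>c. c \<in> set (P0 # Q0 # css) \<Longrightarrow> cyclic_path E c"
    using cov0 unfolding cycle_cover_def by blast
  \<comment> \<open>Rotations that put a prescribed vertex last.\<close>
  have rot: "\<exists>c'. cyclic_path E c' \<and> last c' = u \<and> mset c' = mset c \<and>
      (\<forall>cs. follows \<sigma> (c # cs) \<longrightarrow> follows \<sigma> (c' # cs))"
    if c: "cyclic_path E c" "u \<in> set c" for c u
  proof -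
    obtain A B where AB: "c = A @ B" "A \<noteq> []" "last A = u" using split_after[OF c(2)] by metis
    show ?thesis using c(1) cyclic_path_rotate[of E A B] follows_rotate[of \<sigma> A B] AB
      by (intro exI[of _ "B @ A"]) auto
  qed
  have split: "card S = card (S \<inter> T) + card (S - T)" if "finite S" for S T :: "'a set"
    using that by (metis card_Int_Diff)
  have inside: "3 * k + 2 \<le> card ({x \<in> V. E x (hd P)} \<inter> set P) \<and>
      3 * k + 2 \<le> card ({y \<in> V. E (last P) (\<sigma> y)} \<inter> set P)"
    if cov: "cycle_cover E V (P # cs)" and fol: "follows \<sigma> (P # cs)"
      and len: "length (P # cs) = length (P0 # Q0 # css)" for P cs
  proof -
    have "minimal_cover (P # cs)" using cov noshort len unfolding minimal_cover_def by metis
    from few_neighbours_outside[OF this fol]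
    have few: "card ({x \<in> V. E x (hd P)} - set P) < k" "card ({y \<in> V. E (last P) (\<sigma> y)} - set P) < k"
      by auto
    have "P \<noteq> []" "set P \<subseteq> V" using cov unfolding cycle_cover_def cyclic_path_def by auto
    then have V: "last P \<in> V" "hd P \<in> V" by auto
    show ?thesis
      using few in_large[OF V(2)] card_successor_preimage[OF \<sigma> V(1)]
        split[of "{x \<in> V. E x (hd P)}" "set P"] split[of "{y \<in> V. E (last P) (\<sigma> y)}" "set P"] finite_V
      by force
  qed
  have swap: "cycle_cover E V (Q # P # cs)" if "cycle_cover E V (P # Q # cs)" for P Q cs
    by (rule cycle_cover_cong[OF that]) (use that in \<open>auto simp: cycle_cover_def\<close>)
  have swapf: "follows \<sigma> (Q # P # cs)" if "follows \<sigma> (P # Q # cs)" for P Q cs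
    by (rule follows_subset[OF that]) auto
  have "k \<le> card (set P0)"
    using inside[OF cov0 fol0] card_mono[of "set P0" "{x \<in> V. E x (hd P0)} \<inter> set P0"] by auto
  moreover have "k \<le> card (set Q0)"
    using inside[OF swap[OF cov0] swapf[OF fol0]]
      card_mono[of "set Q0" "{x \<in> V. E x (hd Q0)} \<inter> set Q0"] by auto
  moreover have sub0: "set P0 \<subseteq> V" "set Q0 \<subseteq> V" using cov0 unfolding cycle_cover_def by auto
  moreover have "inj_on \<sigma> (set Q0)"
    by (rule inj_on_subset[OF bij_betw_imp_inj_on[OF \<sigma>] sub0(2)])
  moreover have "\<sigma> ` set Q0 \<subseteq> V"
    using bij_betw_imp_surj_on[OF \<sigma>] sub0(2) by blast
  ultimately obtain a b where ab: "a \<in> set P0" "b \<in> set Q0" "E a (\<sigma> b)"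
    using joined[of "set P0" "\<sigma> ` set Q0"] by (auto simp: card_image)
  obtain P where P: "cyclic_path E P" "last P = a" "mset P = mset P0"
      "\<And>cs. follows \<sigma> (P0 # cs) \<Longrightarrow> follows \<sigma> (P # cs)"
    using rot[of P0 a] cl ab by auto
  obtain Q where Q: "cyclic_path E Q" "last Q = b" "mset Q = mset Q0"
      "\<And>cs. follows \<sigma> (Q0 # cs) \<Longrightarrow> follows \<sigma> (Q # cs)"
    using rot[of Q0 b] cl ab by auto
  have cov: "cycle_cover E V (P # Q # css)"
    by (rule cycle_cover_cong[OF cov0]) (use cl P Q in auto)
  have fol: "follows \<sigma> (P # Q # css)"
    using P(4) Q(4) fol0 swapf by blast
  have dist: "distinct P" "distinct Q" "set P \<subseteq> V" "set Q \<subseteq> V"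
    using cov unfolding cycle_cover_def by auto
  have inj: "inj_on (pos R) S" if "S \<subseteq> set R" for S and R :: "'a list"
    using inj_on_pos that inj_on_subset by blast
  \<comment> \<open>Excluding \<open>a\<close> and \<open>b\<close> keeps the last blocks \<open>A3\<close> and \<open>B3\<close> nonempty.\<close>
  define S where "S = {x \<in> V. E x (hd P)} \<inter> set P - {a}"
  define T where "T = {y \<in> V. E b (\<sigma> y)} \<inter> set Q - {b}"
  have len: "length (R1 # R2 # css) = length (P0 # Q0 # css)" for R1 R2 :: "'a list" by simp
  have card_minus1: "card S - 1 \<le> card (S - {u})" for S :: "'a set" and u
    by (simp add: card_Diff_singleton_if)
  have fin: "finite S" "finite T" by (auto simp: S_def T_def)
  have cS: "3 * k + 1 \<le> card S"
    using inside[OF cov fol len] card_minus1[of "{x \<in> V. E x (hd P)} \<inter> set P" a]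
    unfolding S_def by linarith
  have cT: "3 * k + 1 \<le> card T"
    using inside[OF swap[OF cov] swapf[OF fol] len] card_minus1[of "{y \<in> V. E b (\<sigma> y)} \<inter> set Q" b]
    unfolding T_def Q(2) by linarith
  obtain H where H: "H \<subseteq> S" "card H = k" "\<And>u v. u \<in> S - H \<Longrightarrow> v \<in> H \<Longrightarrow> pos P u < pos P v"
    using highest_subset[OF fin(1) inj[of S P], of k] cS by (auto simp: S_def)
  obtain K where K: "K \<subseteq> T" "card K = k" "\<And>u v. u \<in> K \<Longrightarrow> v \<in> T - K \<Longrightarrow> pos Q u < pos Q v"
    using lowest_subset[OF fin(2) inj[of T Q], of k] cT by (auto simp: T_def)
  have "card (S - H) = card S - k" "card (T - K) = card T - k"
    using H K fin by (metis card_Diff_subset finite_subset)+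
  then have c2: "2 * k \<le> card (S - H)" "2 * k \<le> card (T - K)" using cS cT by linarith+
  have sub: "H \<subseteq> V" "K \<subseteq> V" "S - H \<subseteq> V" "T - K \<subseteq> V"
    using H(1) K(1) dist by (auto simp: S_def T_def)
  obtain x y z w where xyzw: "x \<in> H" "y \<in> K" "z \<in> S - H" "w \<in> T - K"
      "E y (\<sigma> z)" "E z (\<sigma> w)" "E w (\<sigma> x)"
    using connect_via_two[OF \<sigma> sub(1) _ sub(2) _ sub(3) c2(1) sub(4) c2(2)] H(2) K(2)
    by (metis le_refl)
  have in_PQ: "x \<in> S" "y \<in> T" "z \<in> set P" "x \<in> set P" "x \<noteq> a" "y \<in> set Q" "w \<in> set Q" "w \<noteq> b"
    using xyzw H K by (auto simp: S_def T_def)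
  obtain A1 A2 A3 where A: "P = A1 @ A2 @ A3" "A1 \<noteq> []" "A2 \<noteq> []" "last A1 = z" "last A2 = x"
    using split_by_pos[OF dist(1) in_PQ(3,4) H(3)[OF xyzw(3,1)]] by metis
  obtain B1 B2 B3 where B: "Q = B1 @ B2 @ B3" "B1 \<noteq> []" "B2 \<noteq> []" "last B1 = y" "last B2 = w"
    using split_by_pos[OF dist(2) in_PQ(6,7) K(3)[OF xyzw(2,4)]] by metis
  have ne: "A3 \<noteq> []" "B3 \<noteq> []" using A B in_PQ P(2) Q(2) by auto
  have la: "last A3 = a" "last B3 = b" using A B P(2) Q(2) ne by auto
  have "\<sigma> z = hd A2" "\<sigma> x = hd A3" "\<sigma> y = hd B2" "\<sigma> w = hd B3"
    using follows_inner[OF fol, of A1 "A2 @ A3"] follows_inner[OF fol, of "A1 @ A2" A3]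
      follows_inner[OF fol, of B1 "B2 @ B3"] follows_inner[OF fol, of "B1 @ B2" B3] A B ne by auto
  moreover have "\<sigma> b = hd B1" using follows_last[OF fol, of Q] B Q by auto
  moreover have "E x (hd A1)" using in_PQ(1) A unfolding S_def by auto
  moreover have "E b (\<sigma> y)" using in_PQ(2) unfolding T_def by auto
  ultimately have "\<exists>css'. cycle_cover E V css' \<and> length css' < length ((A1 @ A2 @ A3) # (B1 @ B2 @ B3) # css)"
    using A B ne la xyzw ab(3)
    by (intro exchange_two_cycles[OF cov[unfolded A(1) B(1)]]) auto
  then show False using noshort by fastforce
qed

theorem spanning_cyclic_path_exists:
  assumes "V \<noteq> {}"
  shows "\<exists>c. cyclic_path E c \<and> distinct c \<and> set c = V"
proof -
  obtain vs where vs: "set vs = V" "distinct vs" using finite_distinct_list[OF finite_V] by auto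
  have "cycle_cover E V (map (\<lambda>v. [v]) vs)"
    using vs reflexive unfolding cycle_cover_def cyclic_path_def by (auto simp: o_def)
  then obtain css where css: "cycle_cover E V css"
      "\<And>css'. cycle_cover E V css' \<Longrightarrow> length css \<le> length css'"
    using ex_has_least_nat[of "cycle_cover E V" _ length] by blast
  then have "length css \<le> 1" using minimal_cover_single unfolding minimal_cover_def by blast
  moreover have "css \<noteq> []" using css(1) assms unfolding cycle_cover_def by auto
  ultimately obtain c where "css = [c]" by (cases css) auto
  then show ?thesis using css(1) unfolding cycle_cover_def by auto
qed

end

section \<open>Binomial coefficients\<close>

lemma Suc_times_binomial_Suc: "Suc k * (n choose Suc k) = (n - k) * (n choose k)"
proof (cases n)
  case (Suc n')
  show ?thesis
    using Suc_times_binomial[of k n'] binomial_absorb_comp[of n k] unfolding Suc by simp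
qed simp

lemma binomial_Suc_real:
  assumes "k \<le> n"
  shows "real (n choose Suc k) = (real n - real k) / real (Suc k) * real (n choose k)"
proof -
  have "real (Suc k) * real (n choose Suc k) = real (n - k) * real (n choose k)"
    by (metis Suc_times_binomial_Suc of_nat_mult)
  then show ?thesis using assms by (simp add: of_nat_diff field_simps)
qed

text \<open>
  The quotient of the two binomial coefficients is the probability that a random \<open>m\<close>-subset of an
  \<open>N\<close>-set avoids \<open>e\<close> given elements. Choosing the elements one by one, each choice avoids them with
  probability at most \<open>1 - e/N\<close>; for the lower bound that follows, the last choice is the worst one.
\<close>
lemma binomial_diff_upper:
  assumes "m \<le> N" "e \<le> N"
  shows "real ((N - e) choose m) \<le> (1 - real e / real N) ^ m * real (N choose m)"
  using assms(1)
proof (induction m)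
  case (Suc m)
  have nn: "0 \<le> 1 - real e / real N" using assms(2) Suc.prems by (simp add: field_simps)
  show ?case
  proof (cases "m \<le> N - e")
    case True
    have "real (N - e) - real m \<le> (1 - real e / real N) * (real N - real m)"
      using assms(2) Suc.prems True by (simp add: of_nat_diff field_simps)
    then have "real ((N - e) choose Suc m) \<le>
        (1 - real e / real N) * (real N - real m) / real (Suc m) * real ((N - e) choose m)"
      unfolding binomial_Suc_real[OF True] by (intro mult_right_mono divide_right_mono) auto
    also have "\<dots> \<le> (1 - real e / real N) * (real N - real m) / real (Suc m) *
        ((1 - real e / real N) ^ m * real (N choose m))"
      using Suc nn by (intro mult_left_mono) auto
    also have "\<dots> = (1 - real e / real N) ^ Suc m * real (N choose Suc m)"
      using Suc.prems by (subst binomial_Suc_real) auto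
    finally show ?thesis .
  next
    case False
    then show ?thesis using nn by (simp add: binomial_eq_0)
  qed
qed simp

lemma binomial_diff_lower:
  assumes "m < N" "b \<le> N - m"
  shows "(1 - real b / real (N - m)) ^ m * real (N choose m) \<le> real ((N - b) choose m)"
proof -
  let ?x = "1 - real b / real (N - m)"
  have x: "0 \<le> ?x" using assms by (simp add: field_simps)
  have "?x ^ i * real (N choose i) \<le> real ((N - b) choose i)" if "i \<le> m" for i
    using that
  proof (induction i)
    case (Suc i)
    have "real b * real (N - m) \<le> real b * real (N - i)" using Suc.prems by (intro mult_left_mono) auto
    then have *: "?x * (real N - real i) \<le> real (N - b) - real i"
      using assms Suc.prems by (simp add: of_nat_diff field_simps)
    have i: "i \<le> N - b" "i \<le> N" using assms Suc.prems by auto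
    have "?x ^ Suc i * real (N choose Suc i) =
        ?x * (real N - real i) / real (Suc i) * (?x ^ i * real (N choose i))"
      using i by (subst binomial_Suc_real) auto
    also have "\<dots> \<le> ?x * (real N - real i) / real (Suc i) * real ((N - b) choose i)"
      using Suc x i by (intro mult_left_mono) auto
    also have "\<dots> \<le> (real (N - b) - real i) / real (Suc i) * real ((N - b) choose i)"
      using * by (intro mult_right_mono divide_right_mono) auto
    also have "\<dots> = real ((N - b) choose Suc i)" using i by (subst binomial_Suc_real) auto
    finally show ?case .
  qed simp
  then show ?thesis by simp
qed

text \<open>
  Negative correlation: avoiding two disjoint sets of \<open>b\<close> elements is at most as likely as if the
  two events were independent.
\<close>
lemma binomial_diff_log_concave:
  assumes "2 * b \<le> N" "m \<le> N"
  shows "real ((N - 2 * b) choose m) * real (N choose m) \<le> (real ((N - b) choose m))\<^sup>2"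
  using assms(2)
proof (induction m)
  case (Suc m)
  show ?case
  proof (cases "m \<le> N - 2 * b")
    case True
    let ?u = "real (N - 2 * b) - real m" and ?v = "real N - real m" and ?w = "real (N - b) - real m"
    have u: "0 \<le> ?u" "0 \<le> ?v" using True Suc.prems by (auto simp: of_nat_diff)
    have "?u * ?v \<le> ?w\<^sup>2"
      using assms True by (simp add: of_nat_diff power2_eq_square algebra_simps)
    then have "(?u * ?v) * (real ((N - 2 * b) choose m) * real (N choose m)) \<le> ?w\<^sup>2 * (real ((N - b) choose m))\<^sup>2"
      using Suc u by (intro mult_mono) auto
    then have "(?u * ?v) * (real ((N - 2 * b) choose m) * real (N choose m)) / (real (Suc m))\<^sup>2
        \<le> ?w\<^sup>2 * (real ((N - b) choose m))\<^sup>2 / (real (Suc m))\<^sup>2"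
      by (rule divide_right_mono) simp
    moreover have "m \<le> N - b" using True by simp
    ultimately show ?thesis
      using True Suc.prems
      by (subst (1 2 3) binomial_Suc_real) (auto simp: power2_eq_square field_simps)
  next
    case False
    then show ?thesis by (simp add: binomial_eq_0)
  qed
qed simp

text \<open>
  The familiar bound \<open>(en/k)^k\<close>, in a form that combines with other exponentials.
\<close>
lemma binomial_le_exp:
  assumes "1 \<le> k" "k \<le> n"
  shows "real (n choose k) \<le> exp (real k * (1 + ln (real n / real k)))"
proof -
  have "sum (\<lambda>i. real k ^ i /\<^sub>R fact i) {k} \<le> (\<Sum>i. real k ^ i /\<^sub>R fact i)"
    by (rule sum_le_suminf) (use summable_exp_generic[of "real k"] in auto)
  also have "\<dots> = exp (real k)" by (simp add: exp_def)
  finally have k: "real k ^ k \<le> fact k * exp (real k)" by (simp add: field_simps)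
  have "fact k * real (n choose k) \<le> real n ^ k"
  proof -
    have "fact k * (n choose k) \<le> n ^ k"
      by (metis binomial_fact_pow mult.commute)
    then show ?thesis by (metis of_nat_fact of_nat_le_iff of_nat_mult of_nat_power)
  qed
  then have "real (n choose k) \<le> real n ^ k / fact k" by (simp add: field_simps)
  also have "\<dots> \<le> real n ^ k * exp (real k) / real k ^ k"
    using k assms by (simp add: field_simps mult_left_mono)
  also have "\<dots> = exp (real k * (1 + ln (real n / real k)))"
    using assms by (simp add: exp_add exp_of_nat_mult power_divide distrib_left)
  finally show ?thesis .
qed

section \<open>Random sets of given size\<close>

definition random_subset :: "'a set \<Rightarrow> nat \<Rightarrow> 'a set pmf" where
  "random_subset M m = pmf_of_set {R. R \<subseteq> M \<and> card R = m}"

lemma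
  assumes "finite M" "m \<le> card M"
  shows finite_subsets_of_size: "finite {R. R \<subseteq> M \<and> card R = m}"
    and subsets_of_size_nonempty: "{R. R \<subseteq> M \<and> card R = m} \<noteq> {}"
  using assms obtain_subset_with_card_n[of m M] by (auto intro: finite_subset[of _ "Pow M"])

lemma set_pmf_random_subset:
  assumes "finite M" "m \<le> card M"
  shows "set_pmf (random_subset M m) = {R. R \<subseteq> M \<and> card R = m}"
  unfolding random_subset_def
  using finite_subsets_of_size[OF assms] subsets_of_size_nonempty[OF assms] by simp

lemma prob_avoid:
  assumes "finite M" "m \<le> card M" "F \<subseteq> M"
  shows "measure_pmf.prob (random_subset M m) {R. R \<inter> F = {}} =
    real ((card M - card F) choose m) / real (card M choose m)"
proof -
  have "{R. R \<subseteq> M \<and> card R = m} \<inter> {R. R \<inter> F = {}} = {R. R \<subseteq> M - F \<and> card R = m}" by auto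
  moreover have "card (M - F) = card M - card F"
    using assms by (meson card_Diff_subset finite_subset)
  ultimately show ?thesis
    unfolding random_subset_def
    using assms finite_subsets_of_size[OF assms(1,2)] subsets_of_size_nonempty[OF assms(1,2)]
    by (simp add: measure_pmf_of_set n_subsets)
qed

text \<open>
  Chebyshev's inequality for the number of events that occur: negative correlation bounds the
  variance of this number by the sum of the variances of the indicators, so by \<open>card B\<close>.
\<close>
lemma few_events_unlikely:
  fixes p :: "'a pmf" and A :: "'b \<Rightarrow> 'a set"
  assumes fin: "finite (set_pmf p)" "finite B"
    and corr: "\<And>v w. v \<in> B \<Longrightarrow> w \<in> B \<Longrightarrow> v \<noteq> w \<Longrightarrow>
      measure_pmf.prob p (A v \<inter> A w) \<le> measure_pmf.prob p (A v) * measure_pmf.prob p (A w)"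
    and t: "t < (\<Sum>v\<in>B. measure_pmf.prob p (A v))"
  shows "measure_pmf.prob p {x. real (card {v \<in> B. x \<in> A v}) \<le> t}
    \<le> real (card B) / ((\<Sum>v\<in>B. measure_pmf.prob p (A v)) - t)\<^sup>2"
proof -
  define \<mu> where "\<mu> = (\<Sum>v\<in>B. measure_pmf.prob p (A v))"
  define X :: "'a \<Rightarrow> real" where "X = (\<lambda>x. \<Sum>v\<in>B. indicator (A v) x)"
  have int: "integrable (measure_pmf p) f" for f :: "'a \<Rightarrow> real"
    by (rule integrable_measure_pmf_finite[OF fin(1)])
  have card: "real (card {v \<in> B. x \<in> A v}) = X x" for x
  proof -
    have "X x = (\<Sum>v\<in>B. if x \<in> A v then 1 else 0)"
      unfolding X_def by (intro sum.cong) (auto simp: indicator_def)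
    then show ?thesis using fin(2) by (simp add: sum.If_cases Int_def)
  qed
  have EX: "measure_pmf.expectation p X = \<mu>"
    unfolding X_def \<mu>_def by (subst Bochner_Integration.integral_sum) (auto intro: int)
  have "(\<lambda>x. (X x)\<^sup>2) = (\<lambda>x. \<Sum>v\<in>B. \<Sum>w\<in>B. indicator (A v \<inter> A w) x)"
    unfolding X_def power2_eq_square sum_product by (simp add: indicator_inter_arith)
  then have "measure_pmf.expectation p (\<lambda>x. (X x)\<^sup>2) = (\<Sum>v\<in>B. \<Sum>w\<in>B. measure_pmf.prob p (A v \<inter> A w))"
    by (simp add: Bochner_Integration.integral_sum int)
  also have "\<dots> \<le> (\<Sum>v\<in>B. \<Sum>w\<in>B. measure_pmf.prob p (A v) * measure_pmf.prob p (A w) + (if v = w then 1 else 0))"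
  proof (intro sum_mono)
    fix v w assume vw: "v \<in> B" "w \<in> B"
    show "measure_pmf.prob p (A v \<inter> A w)
        \<le> measure_pmf.prob p (A v) * measure_pmf.prob p (A w) + (if v = w then 1 else 0)"
      using corr[OF vw] by (cases "v = w") (auto intro: order_trans[OF measure_pmf.prob_le_1])
  qed
  also have "\<dots> = \<mu>\<^sup>2 + real (card B)"
    using fin(2) by (simp add: sum.distrib \<mu>_def power2_eq_square sum_product)
  finally have var: "measure_pmf.variance p X \<le> real (card B)"
    by (subst measure_pmf.variance_eq) (auto simp: int EX)
  have pos: "0 < \<mu> - t" using t unfolding \<mu>_def by simp
  have "measure_pmf.prob p {x. real (card {v \<in> B. x \<in> A v}) \<le> t}
      \<le> measure_pmf.prob p {x \<in> space (measure_pmf p). \<mu> - t \<le> \<bar>X x - measure_pmf.expectation p X\<bar>}"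
    unfolding card EX by (intro measure_pmf.finite_measure_mono) auto
  also have "\<dots> \<le> measure_pmf.variance p X / (\<mu> - t)\<^sup>2"
    by (rule measure_pmf.Chebyshev_inequality) (use pos in \<open>auto simp: int\<close>)
  also have "\<dots> \<le> real (card B) / (\<mu> - t)\<^sup>2"
    using var by (rule divide_right_mono) simp
  finally show ?thesis unfolding \<mu>_def .
qed

section \<open>Sufficiently many random arcs\<close>

lemma consecutive_pairs:
  assumes "successively R (u # cs @ [v])" "(a, b) \<in> set (zip (u # cs) (cs @ [v]))"
  shows "R a b"
  using assms by (induction cs arbitrary: u) auto

lemma pcas_consecutive: "pcas u (zip (u # cs) (cs @ [v])) v"
  by (induction cs arbitrary: u) auto

lemma pawalk_verts_consecutive: "pawalk_verts u (zip (u # cs) (cs @ [v])) = u # cs @ [v]"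
  by (induction cs arbitrary: u) auto

lemma distinct_successively: "distinct xs \<Longrightarrow> successively (\<noteq>) xs"
  by (induction xs rule: induct_list012) auto

text \<open>
  A list of at least two distinct vertices never steps from a vertex to itself, so all of its steps
  are arcs of \<open>G\<close>.
\<close>
lemma hamiltonian_of_cyclic_path:
  assumes c: "cyclic_path (\<lambda>u v. u = v \<or> (u, v) \<in> parcs G) c" "distinct c" "set c = pverts G"
    and len: "2 \<le> length c"
  shows "hamiltonian (with_proj G)"
proof -
  obtain u cs where ucs: "c = u # cs" "cs \<noteq> []" using len by (cases c; cases "tl c") auto
  let ?p = "zip (u # cs) (cs @ [u])"
  have "successively (\<lambda>u v. u = v \<or> (u, v) \<in> parcs G) ((u # cs) @ [u])"
    using c ucs unfolding cyclic_path_def by (subst successively_append_iff) auto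
  then have arc: "a = b \<or> (a, b) \<in> parcs G" if "(a, b) \<in> set ?p" for a b
    using consecutive_pairs[OF _ that] by fastforce
  have "successively (\<noteq>) ((u # cs) @ [u])"
    using distinct_successively[OF c(2)] c(2) ucs by (subst successively_append_iff) auto
  then have "a \<noteq> b" if "(a, b) \<in> set ?p" for a b
    using consecutive_pairs[OF _ that] by fastforce
  then have sub: "set ?p \<subseteq> parcs G" using arc by auto
  have "map fst ?p = u # cs" by (rule map_fst_zip) simp
  then have "fst ` set ?p = pverts G" using c(3) ucs(1) by (metis set_map)
  moreover have "pre_digraph.cycle (with_proj G) ?p"
    unfolding pre_digraph.cycle_def pre_digraph.awalk_def cas_with_proj_eq awalk_verts_with_proj_eq
    using c ucs sub
    by (intro exI[of _ u]) (auto simp: pcas_consecutive pawalk_verts_consecutive simp del: zip_Cons_Cons zip_Cons)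
  ultimately show ?thesis unfolding hamiltonian_def with_proj_simps by blast
qed

lemma dense_digraphs_degree:
  assumes "H \<in> dense_digraphs n d" "v \<in> {1..n}"
  shows "d * real n \<le> real (card {u. (v, u) \<in> parcs H})" "d * real n \<le> real (card {u. (u, v) \<in> parcs H})"
proof -
  have V: "pverts H = {1..n}" and deg: "d * real n \<le> real (min_semidegree (with_proj H))"
    using assms unfolding dense_digraphs_def by auto
  have "min_semidegree (with_proj H) \<le> out_degree (with_proj H) v"
    unfolding min_semidegree_def min_out_degree_def
    using assms(2) V by (intro min.coboundedI1 Min_le) auto
  moreover have "min_semidegree (with_proj H) \<le> in_degree (with_proj H) v"
    unfolding min_semidegree_def min_in_degree_def
    using assms(2) V by (intro min.coboundedI2 Min_le) auto
  moreover have "out_degree (with_proj H) v = card {u. (v, u) \<in> parcs H}"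
  proof -
    have "out_arcs (with_proj H) v = Pair v ` {u. (v, u) \<in> parcs H}" by auto
    then show ?thesis unfolding out_degree_def by (simp add: card_image inj_on_def)
  qed
  moreover have "in_degree (with_proj H) v = card {u. (u, v) \<in> parcs H}"
  proof -
    have "in_arcs (with_proj H) v = (\<lambda>u. (u, v)) ` {u. (u, v) \<in> parcs H}" by auto
    then show ?thesis unfolding in_degree_def by (simp add: card_image inj_on_def)
  qed
  ultimately show "d * real n \<le> real (card {u. (v, u) \<in> parcs H})"
    "d * real n \<le> real (card {u. (u, v) \<in> parcs H})"
    using deg by linarith+
qed

lemma hamiltonian_of_joined:
  assumes H: "H \<in> dense_digraphs n d" and R: "R \<subseteq> missing_arcs H"
    and k: "1 \<le> k" "4 * real k \<le> d * real n" and n: "2 \<le> n"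
    and joined: "\<And>S T. S \<subseteq> {1..n} \<Longrightarrow> T \<subseteq> {1..n} \<Longrightarrow> card S = k \<Longrightarrow> card T = k \<Longrightarrow>
      S \<inter> T = {} \<Longrightarrow> (parcs H \<union> R) \<inter> S \<times> T \<noteq> {}"
  shows "hamiltonian (with_proj (add_arcs H R))"
proof -
  define E where "E u v \<longleftrightarrow> u = v \<or> (u, v) \<in> parcs (add_arcs H R)" for u v
  have H': "pair_digraph H" "pverts H = {1..n}" using H unfolding dense_digraphs_def by auto
  have arcs: "(u, v) \<in> parcs H \<Longrightarrow> u \<in> {1..n} \<and> v \<in> {1..n} \<and> u \<noteq> v" for u v
    using H' pair_digraph.axioms(1) pair_digraph.axioms(2) pair_fin_digraph.axioms(1)
      pair_wf_digraph.in_arcsD1 pair_wf_digraph.in_arcsD2 pair_loopfree_digraph.pair_no_loops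
    by (metis fst_conv snd_conv)
  have parcs: "parcs (add_arcs H R) = parcs H \<union> R" unfolding add_arcs_def by simp
  interpret joined_digraph "{1..n}" E k
  proof
    fix v assume v: "v \<in> {1..n}"
    let ?O = "{u. (v, u) \<in> parcs H}" and ?I = "{u. (u, v) \<in> parcs H}"
    have fin: "finite ?O" "finite ?I" using arcs by (auto intro: finite_subset[of _ "{1..n}"])
    have "4 * k \<le> card ?O" "4 * k \<le> card ?I"
      using dense_digraphs_degree[OF H v] k by linarith+
    moreover have "v \<notin> ?O" "v \<notin> ?I" using arcs by auto
    ultimately have "4 * k + 1 \<le> card (insert v ?O)" "4 * k + 1 \<le> card (insert v ?I)"
      using fin by auto
    moreover have "card (insert v ?O) \<le> card {u \<in> {1..n}. E v u}"
      "card (insert v ?I) \<le> card {u \<in> {1..n}. E u v}"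
      using v arcs by (intro card_mono; auto simp: E_def parcs)+
    ultimately show "4 * k + 1 \<le> card {u \<in> {1..n}. E v u}" "4 * k + 1 \<le> card {u \<in> {1..n}. E u v}"
      by linarith+
  next
    fix S T :: "nat set"
    assume ST: "S \<subseteq> {1..n}" "T \<subseteq> {1..n}" "k \<le> card S" "k \<le> card T"
    show "\<exists>a\<in>S. \<exists>b\<in>T. E a b"
    proof (cases "S \<inter> T = {}")
      case True
      obtain S' T' where ST': "S' \<subseteq> S" "card S' = k" "T' \<subseteq> T" "card T' = k"
        using obtain_subset_with_card_n ST by metis
      have "(parcs H \<union> R) \<inter> S' \<times> T' \<noteq> {}"
        by (rule joined) (use ST ST' True in blast)+
      then obtain a b where "(a, b) \<in> parcs H \<union> R" "a \<in> S'" "b \<in> T'" by blast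
      then show ?thesis using ST' unfolding E_def parcs by blast
    qed (auto simp: E_def)
  qed (use k in \<open>auto simp: E_def\<close>)
  obtain c where c: "cyclic_path E c" "distinct c" "set c = {1..n}"
    using spanning_cyclic_path_exists n by auto
  then have "length c = n" using distinct_card[of c] by simp
  moreover have "pverts (add_arcs H R) = {1..n}" using H' unfolding add_arcs_def by simp
  moreover have "E = (\<lambda>u v. u = v \<or> (u, v) \<in> parcs (add_arcs H R))"
    by (intro ext) (rule E_def)
  ultimately show ?thesis using c n by (intro hamiltonian_of_cyclic_path[of _ c]) simp_all
qed

text \<open>
  A union bound over the pairs \<open>(S, T)\<close> that are not joined by an arc outside \<open>M\<close>.
\<close>
lemma prob_not_joined:
  assumes n: "1 \<le> k" "1 \<le> n" and M: "M \<subseteq> {1..n} \<times> {1..n}" "m \<le> card M"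
  shows "measure_pmf.prob (random_subset M m)
      {R. \<exists>S T. S \<subseteq> {1..n} \<and> T \<subseteq> {1..n} \<and> card S = k \<and> card T = k \<and> S \<times> T \<subseteq> M \<and> R \<inter> S \<times> T = {}}
    \<le> (real (n choose k))\<^sup>2 * (1 - (real k)\<^sup>2 / (real n)\<^sup>2) ^ m"
proof -
  let ?p = "random_subset M m" and ?K = "{S. S \<subseteq> {1..n} \<and> card S = k}"
  define Q where "Q = {ST \<in> ?K \<times> ?K. fst ST \<times> snd ST \<subseteq> M}"
  have finM: "finite M" using M finite_subset by blast
  have finK: "finite ?K" by (rule finite_subset[of _ "Pow {1..n}"]) auto
  have finQ: "finite Q" unfolding Q_def using finK by auto
  have "card Q \<le> card (?K \<times> ?K)" unfolding Q_def by (rule card_mono) (use finK in auto)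
  also have "\<dots> = (n choose k)\<^sup>2" by (simp add: card_cartesian_product n_subsets power2_eq_square)
  finally have cQ: "real (card Q) \<le> (real (n choose k))\<^sup>2" by (metis of_nat_le_iff of_nat_power)
  have cM: "card M \<le> n * n" using card_mono[OF _ M(1)] by (simp add: card_cartesian_product)
  have each: "measure_pmf.prob ?p {R. R \<inter> fst ST \<times> snd ST = {}} \<le> (1 - (real k)\<^sup>2 / (real n)\<^sup>2) ^ m"
    if "ST \<in> Q" for ST
  proof -
    obtain S T where ST: "ST = (S, T)" by (cases ST)
    have sub: "S \<times> T \<subseteq> M" "card (S \<times> T) = k * k"
      using that unfolding Q_def ST by (auto simp: card_cartesian_product)
    then have kM: "k * k \<le> card M" using card_mono[OF finM sub(1)] by simp
    have "measure_pmf.prob ?p {R. R \<inter> S \<times> T = {}}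
        = real ((card M - k * k) choose m) / real (card M choose m)"
      using prob_avoid[OF finM M(2) sub(1)] sub(2) by simp
    also have "\<dots> \<le> (1 - real (k * k) / real (card M)) ^ m"
      using binomial_diff_upper[OF M(2) kM] M(2) by (simp add: divide_le_eq)
    also have "\<dots> \<le> (1 - (real k)\<^sup>2 / (real n)\<^sup>2) ^ m"
    proof (rule power_mono)
      have pos: "0 < card M" using kM n by (auto intro: Nat.gr0I)
      show "0 \<le> 1 - real (k * k) / real (card M)"
        using kM pos by (simp add: divide_le_eq flip: of_nat_mult)
      have "real (card M) \<le> real n * real n" using cM by (metis of_nat_le_iff of_nat_mult)
      then have "real (k * k) / (real n * real n) \<le> real (k * k) / real (card M)"
        using pos by (intro divide_left_mono) auto
      then show "1 - real (k * k) / real (card M) \<le> 1 - (real k)\<^sup>2 / (real n)\<^sup>2"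
        by (simp add: power2_eq_square)
    qed
    finally show ?thesis by (simp add: ST)
  qed
  have "measure_pmf.prob ?p
      {R. \<exists>S T. S \<subseteq> {1..n} \<and> T \<subseteq> {1..n} \<and> card S = k \<and> card T = k \<and> S \<times> T \<subseteq> M \<and> R \<inter> S \<times> T = {}}
      \<le> measure_pmf.prob ?p (\<Union>ST\<in>Q. {R. R \<inter> fst ST \<times> snd ST = {}})"
  proof (rule measure_pmf.finite_measure_mono, safe)
    fix R S T
    assume "S \<subseteq> {1..n}" "T \<subseteq> {1..n}" "card T = card S" "k = card S" "S \<times> T \<subseteq> M" and e: "R \<inter> S \<times> T = {}"
    then have "(S, T) \<in> Q" unfolding Q_def by auto
    then show "R \<in> (\<Union>ST\<in>Q. {R. R \<inter> fst ST \<times> snd ST = {}})" using e by force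
  qed auto
  also have "\<dots> \<le> (\<Sum>ST\<in>Q. measure_pmf.prob ?p {R. R \<inter> fst ST \<times> snd ST = {}})"
    by (rule measure_pmf.finite_measure_subadditive_finite) (auto simp: finQ)
  also have "\<dots> \<le> (\<Sum>ST\<in>Q. (1 - (real k)\<^sup>2 / (real n)\<^sup>2) ^ m)" by (rule sum_mono) (rule each)
  also have "\<dots> = real (card Q) * (1 - (real k)\<^sup>2 / (real n)\<^sup>2) ^ m" by simp
  also have "\<dots> \<le> (real (n choose k))\<^sup>2 * (1 - (real k)\<^sup>2 / (real n)\<^sup>2) ^ m"
  proof (cases "k \<le> n")
    case True
    then have "(real k)\<^sup>2 / (real n)\<^sup>2 \<le> 1" using n by (simp add: divide_le_eq power_mono)
    then show ?thesis using cQ by (intro mult_right_mono) auto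
  next
    case False
    then show ?thesis using cQ by (simp add: binomial_eq_0)
  qed
  finally show ?thesis .
qed

text \<open>
  The union bound for sets of linear size and linearly many random arcs: for \<open>k = l * n\<close> and
  \<open>m = C * n\<close> it is at most the exponential of \<open>k * (2 + 2 * ln (1/l) - l * C)\<close>.
\<close>
lemma union_bound_exp:
  fixes l C :: real
  assumes l: "0 < l" and k: "l * real n \<le> real k" "k \<le> n" "1 \<le> k" and m: "C * real n \<le> real m"
    and c: "0 \<le> l * C - 2 - 2 * ln (1 / l)" and C: "0 \<le> C"
  shows "(real (n choose k))\<^sup>2 * (1 - (real k)\<^sup>2 / (real n)\<^sup>2) ^ m
    \<le> exp (- (l * C - 2 - 2 * ln (1 / l)) * (l * real n))"
proof -
  have n: "0 < real n" using k by auto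
  let ?x = "(real k)\<^sup>2 / (real n)\<^sup>2"
  have x1: "?x \<le> 1" using k n by (simp add: divide_le_eq power_mono)
  have "1 - ?x \<le> exp (- ?x)" using exp_ge_add_one_self[of "- ?x"] by simp
  then have "(1 - ?x) ^ m \<le> exp (- ?x) ^ m" using x1 by (intro power_mono) auto
  also have "\<dots> = exp (- (?x * real m))" by (simp add: exp_of_nat_mult[symmetric] mult.commute)
  also have "\<dots> \<le> exp (- (real k * (l * C)))"
  proof -
    have "real k * (l * C) \<le> real k * (real k / real n * C)"
      using k n C l by (intro mult_left_mono mult_right_mono) (auto simp: field_simps)
    also have "\<dots> = ?x * (C * real n)" using n by (simp add: power2_eq_square field_simps)
    also have "\<dots> \<le> ?x * real m" using m by (intro mult_left_mono) auto
    finally show ?thesis by simp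
  qed
  finally have 1: "(1 - ?x) ^ m \<le> exp (- (real k * (l * C)))" .
  have "real (n choose k) \<le> exp (real k * (1 + ln (real n / real k)))"
    using binomial_le_exp k by blast
  also have "\<dots> \<le> exp (real k * (1 + ln (1 / l)))"
  proof -
    have "real n / real k \<le> 1 / l" using k l by (simp add: field_simps)
    then have "ln (real n / real k) \<le> ln (1 / l)" using k n l by (subst ln_le_cancel_iff) auto
    then show ?thesis by (simp add: mult_left_mono)
  qed
  finally have "(real (n choose k))\<^sup>2 \<le> (exp (real k * (1 + ln (1 / l))))\<^sup>2" by (rule power_mono) simp
  also have "\<dots> = exp (real k * (2 + 2 * ln (1 / l)))"
    by (simp add: power2_eq_square algebra_simps flip: exp_add)
  finally have 2: "(real (n choose k))\<^sup>2 \<le> exp (real k * (2 + 2 * ln (1 / l)))" .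
  have "(real (n choose k))\<^sup>2 * (1 - ?x) ^ m
      \<le> exp (real k * (2 + 2 * ln (1 / l))) * exp (- (real k * (l * C)))"
    using x1 by (intro mult_mono 1 2) auto
  also have "\<dots> = exp (- ((l * C - 2 - 2 * ln (1 / l)) * real k))"
    by (simp add: algebra_simps flip: exp_add)
  also have "\<dots> \<le> exp (- ((l * C - 2 - 2 * ln (1 / l)) * (l * real n)))"
    using c k(1) by (simp add: mult_left_mono)
  finally show ?thesis by (simp only: minus_mult_left)
qed

text \<open>
  Up to a bound for \<open>ln (25/6)\<close>, the claim is \<open>7/5 + 14/25 \<theta> < 6/5 d^(-1)\<close>, and \<open>\<theta> \<le> d^(-1) - 1\<close>.
  The choice \<open>l = 6d/25\<close> is a little below \<open>d/4\<close>, because \<open>4k\<close> has to stay below \<open>dn\<close> after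
  rounding.
\<close>
lemma exponent_positive:
  fixes d \<theta> :: real
  assumes d: "0 < d" "d < 1 / 2" and \<theta>: "\<theta> = ln (inverse d)"
  defines "l \<equiv> 6 * d / 25" and "C \<equiv> inverse d * (15 + 6 * \<theta>) + 5 * inverse (d ^ 2)"
  shows "0 < l * C - 2 - 2 * ln (1 / l)"
proof -
  have "(25 / 6 :: real) \<le> exp (3 / 2)"
  proof -
    have "(13 / 8 :: real) \<le> exp (1 / 2)"
      using exp_lower_Taylor_quadratic[of "1 / 2 :: real"] by (simp add: power2_eq_square)
    then have "(13 / 8 :: real) ^ 3 \<le> exp (1 / 2) ^ 3" by (rule power_mono) simp
    also have "\<dots> = exp (3 / 2 :: real)" by (simp flip: exp_of_nat_mult)
    finally show ?thesis by (simp add: power3_eq_cube)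
  qed
  then have a: "ln (25 / 6) \<le> (3 / 2 :: real)" by (metis exp_gt_zero ln_exp ln_le_cancel_iff divide_pos_pos zero_less_numeral)
  have "1 / l = 25 / 6 * inverse d" using d by (simp add: l_def field_simps)
  then have "ln (1 / l) = ln (25 / 6 * inverse d)" by (rule arg_cong)
  also have "\<dots> = ln (25 / 6) + \<theta>" unfolding \<theta> using d by (intro ln_mult_pos) auto
  finally have "ln (1 / l) = ln (25 / 6) + \<theta>" .
  moreover have "l * C = 18 / 5 + 36 / 25 * \<theta> + 6 / 5 * inverse d"
    using d by (simp add: l_def C_def field_simps power2_eq_square)
  moreover have "\<theta> \<le> inverse d - 1" using ln_le_minus_one[of "inverse d"] d \<theta> by simp
  moreover have "2 < inverse d" using d by (simp add: field_simps)
  ultimately show ?thesis using a by linarith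
qed

lemma prob_hamiltonian:
  assumes H: "H \<in> dense_digraphs n d" and m: "m \<le> card (missing_arcs H)"
    and k: "1 \<le> k" "4 * real k \<le> d * real n" and n: "2 \<le> n"
  shows "1 - (real (n choose k))\<^sup>2 * (1 - (real k)\<^sup>2 / (real n)\<^sup>2) ^ m
    \<le> measure_pmf.prob (perturbed_digraph H m) {D. hamiltonian (with_proj D)}"
proof -
  let ?M = "missing_arcs H"
  have M: "?M \<subseteq> {1..n} \<times> {1..n}" using H by (auto simp: missing_arcs_def dense_digraphs_def)
  then have finM: "finite ?M" using finite_subset by blast
  define Bad where "Bad = {R. \<exists>S T. S \<subseteq> {1..n} \<and> T \<subseteq> {1..n} \<and> card S = k \<and> card T = k \<and>
    S \<times> T \<subseteq> ?M \<and> R \<inter> S \<times> T = {}}"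
  have ham: "hamiltonian (with_proj (add_arcs H R))" if "R \<in> set_pmf (random_subset ?M m)" "R \<notin> Bad" for R
  proof (rule hamiltonian_of_joined[OF H _ k n])
    show "R \<subseteq> ?M" using that(1) set_pmf_random_subset[OF finM m] by auto
    fix S T :: "nat set"
    assume ST: "S \<subseteq> {1..n}" "T \<subseteq> {1..n}" "card S = k" "card T = k"
    show "(parcs H \<union> R) \<inter> S \<times> T \<noteq> {}"
    proof
      assume e: "(parcs H \<union> R) \<inter> S \<times> T = {}"
      then have "S \<times> T \<subseteq> ?M" using ST H by (auto simp: missing_arcs_def dense_digraphs_def)
      moreover have "R \<inter> S \<times> T = {}" using e by auto
      ultimately show False using that(2) ST unfolding Bad_def by blast
    qed
  qed
  have "1 - measure_pmf.prob (random_subset ?M m) Bad = measure_pmf.prob (random_subset ?M m) (- Bad)"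
    using measure_pmf.prob_compl[of Bad "random_subset ?M m"] by (simp add: Compl_eq_Diff_UNIV)
  also have "\<dots> \<le> measure_pmf.prob (random_subset ?M m) {R. hamiltonian (with_proj (add_arcs H R))}"
    using ham by (intro measure_pmf.finite_measure_mono_AE AE_pmfI) auto
  also have "\<dots> = measure_pmf.prob (perturbed_digraph H m) {D. hamiltonian (with_proj D)}"
    unfolding perturbed_digraph_def random_subset_def by (simp add: vimage_def)
  finally show ?thesis using prob_not_joined[OF k(1) _ M m] n unfolding Bad_def by fastforce
qed

theorem whp_hamiltonian:
  fixes d \<theta> :: real and H :: "nat \<Rightarrow> nat pair_pre_digraph"
  assumes d: "0 < d" "d < 1 / 2" and \<theta>: "\<theta> = ln (inverse d)"
    and ev: "\<forall>\<^sub>F n in sequentially. H n \<in> dense_digraphs n d \<and> m n \<le> card (missing_arcs (H n)) \<and>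
      real (m n) \<ge> (inverse d * (15 + 6 * \<theta>) + 5 * inverse (d ^ 2)) * real n"
  shows "whp (\<lambda>n. perturbed_digraph (H n) (m n)) (\<lambda>D. hamiltonian (with_proj D))"
proof -
  define l where "l = 6 * d / 25"
  define C where "C = inverse d * (15 + 6 * \<theta>) + 5 * inverse (d ^ 2)"
  define c where "c = l * C - 2 - 2 * ln (1 / l)"
  have c: "0 < c" using exponent_positive[OF d \<theta>] by (simp add: c_def l_def C_def)
  have l: "0 < l" "l < 1" using d by (auto simp: l_def)
  have "0 \<le> \<theta>" using d \<theta> by (simp add: field_simps)
  then have C: "0 \<le> C" using d by (auto simp: C_def)
  let ?P = "\<lambda>n. measure_pmf.prob (perturbed_digraph (H n) (m n)) {D. hamiltonian (with_proj D)}"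
  have low: "\<forall>\<^sub>F n in sequentially. 1 - exp (- c * (l * real n)) \<le> ?P n"
    using ev eventually_ge_at_top[of "nat \<lceil>100 / d\<rceil> + 2"]
  proof eventually_elim
    case (elim n)
    then have H: "H n \<in> dense_digraphs n d" "m n \<le> card (missing_arcs (H n))" "C * real n \<le> real (m n)"
      by (auto simp: C_def)
    have n: "2 \<le> n" "100 / d \<le> real n" using elim by linarith+
    then have dn: "100 \<le> d * real n" using d by (simp add: field_simps)
    define k where "k = nat \<lceil>l * real n\<rceil>"
    have lk: "l * real n \<le> real k" "real k < l * real n + 1"
      using l ceiling_correct[of "l * real n"] unfolding k_def by auto
    \<comment> \<open>Rounding up costs at most \<open>4\<close> in \<open>4 * k\<close>, and \<open>4 * l * n\<close> is below \<open>d * n\<close> by \<open>d * n / 25\<close>.\<close>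
    have k4: "4 * real k \<le> d * real n" using lk(2) dn by (simp add: l_def)
    have k1: "1 \<le> k" using lk(1) dn by (simp add: l_def)
    have "d * real n \<le> real n" using d by (simp add: mult_left_le_one_le)
    then have kn: "k \<le> n" using k4 by linarith
    show ?case
      using prob_hamiltonian[OF H(1,2) k1 k4 n(1)] union_bound_exp[OF l(1) lk(1) kn k1 H(3) _ C] c
      unfolding c_def by linarith
  qed
  have "(\<lambda>n. 1 - exp (- c * (l * real n))) \<longlonglongrightarrow> 1" using c l by real_asymp
  from tendsto_sandwich[OF low _ this tendsto_const] show ?thesis unfolding whp_def by simp
qed

section \<open>Too few random arcs\<close>

definition bipartite_digraph :: "nat \<Rightarrow> nat \<Rightarrow> nat pair_pre_digraph" where
  "bipartite_digraph n a =
     \<lparr>pverts = {1..n}, parcs = {1..a} \<times> {a<..n} \<union> {a<..n} \<times> {1..a}\<rparr>"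

lemma bipartite_digraph_dense:
  assumes "1 \<le> n" "a \<le> n" "d * real n \<le> real a" "d * real n \<le> real (n - a)"
  shows "bipartite_digraph n a \<in> dense_digraphs n d"
proof -
  let ?H = "bipartite_digraph n a"
  have 1: "pair_digraph ?H"
    unfolding bipartite_digraph_def using assms(2) by unfold_locales auto
  have V: "pverts ?H = {1..n}" by (simp add: bipartite_digraph_def)
  have out: "min a (n - a) \<le> out_degree (with_proj ?H) v" if v: "v \<in> {1..n}" for v
  proof (cases "v \<le> a")
    case True
    then have "out_arcs (with_proj ?H) v = {v} \<times> {a<..n}"
      using v by (auto simp: bipartite_digraph_def out_arcs_def)
    then show ?thesis by (simp add: out_degree_def card_cartesian_product)
  next
    case False
    then have "out_arcs (with_proj ?H) v = {v} \<times> {1..a}"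
      using v by (auto simp: bipartite_digraph_def out_arcs_def)
    then show ?thesis by (simp add: out_degree_def card_cartesian_product)
  qed
  have inn: "min a (n - a) \<le> in_degree (with_proj ?H) v" if v: "v \<in> {1..n}" for v
  proof (cases "v \<le> a")
    case True
    then have "in_arcs (with_proj ?H) v = {a<..n} \<times> {v}"
      using v by (auto simp: bipartite_digraph_def in_arcs_def)
    then show ?thesis by (simp add: in_degree_def card_cartesian_product)
  next
    case False
    then have "in_arcs (with_proj ?H) v = {1..a} \<times> {v}"
      using v by (auto simp: bipartite_digraph_def in_arcs_def)
    then show ?thesis by (simp add: in_degree_def card_cartesian_product)
  qed
  have "min a (n - a) \<le> min_semidegree (with_proj ?H)"
    unfolding min_semidegree_def min_out_degree_def min_in_degree_def with_proj_simps V
  proof (rule min.boundedI)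
    show "min a (n - a) \<le> Min (out_degree (with_proj ?H) ` {1..n})"
      by (rule Min.boundedI) (use out assms(1) in auto)
    show "min a (n - a) \<le> Min (in_degree (with_proj ?H) ` {1..n})"
      by (rule Min.boundedI) (use inn assms(1) in auto)
  qed
  then have "real (min a (n - a)) \<le> real (min_semidegree (with_proj ?H))" by (rule of_nat_mono)
  moreover have "d * real n \<le> real (min a (n - a))" using assms by (simp add: min_def)
  ultimately show ?thesis using 1 V unfolding dense_digraphs_def by auto
qed

lemma missing_arcs_bipartite:
  assumes "a \<le> n"
  shows "missing_arcs (bipartite_digraph n a) = {1..a} \<times> {1..a} \<union> {a<..n} \<times> {a<..n}"
  using assms unfolding missing_arcs_def bipartite_digraph_def by auto

lemma card_missing_arcs_bipartite:
  assumes "a \<le> n"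
  shows "card (missing_arcs (bipartite_digraph n a)) = a * a + (n - a) * (n - a)"
  unfolding missing_arcs_bipartite[OF assms]
  by (subst card_Un_disjoint) (auto simp: card_cartesian_product)

text \<open>
  Successors on a cycle are distinct, and those of the vertices in question lie in \<open>{1..a}\<close>.
\<close>
lemma hamiltonian_bipartite_bound:
  assumes a: "a \<le> n" and R: "R \<subseteq> missing_arcs (bipartite_digraph n a)"
    and ham: "hamiltonian (with_proj (add_arcs (bipartite_digraph n a) R))"
  shows "card {v \<in> {a<..n}. R \<inter> {v} \<times> {a<..n} = {}} \<le> a"
proof -
  let ?D = "add_arcs (bipartite_digraph n a) R"
  let ?I = "{v \<in> {a<..n}. R \<inter> {v} \<times> {a<..n} = {}}"
  obtain p where p: "pre_digraph.cycle (with_proj ?D) p" "fst ` set p = {1..n}"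
    using ham unfolding hamiltonian_def by (auto simp: add_arcs_def bipartite_digraph_def)
  then obtain u where u: "set p \<subseteq> parcs ?D" "pcas u p u" "distinct (tl (pawalk_verts u p))" "p \<noteq> []"
    unfolding pre_digraph.cycle_def pre_digraph.awalk_def cas_with_proj_eq awalk_verts_with_proj_eq
    by auto
  have heads: "pcas u p v \<Longrightarrow> pawalk_verts u p = u # map snd p" for u v p
    by (induction p arbitrary: u) auto
  have "distinct (map snd p)" using u(3) heads[OF u(2)] by simp
  then have inj: "inj_on snd (set p)" by (simp add: distinct_map)
  have "\<forall>v\<in>?I. \<exists>w. (v, w) \<in> set p"
  proof
    fix v assume "v \<in> ?I"
    then have "v \<in> fst ` set p" unfolding p(2) by auto
    then show "\<exists>w. (v, w) \<in> set p" by auto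
  qed
  from bchoice[OF this] obtain f where f: "\<And>v. v \<in> ?I \<Longrightarrow> (v, f v) \<in> set p" by blast
  have "f ` ?I \<subseteq> {1..a}"
  proof
    fix w assume "w \<in> f ` ?I"
    then obtain v where v: "v \<in> {a<..n}" "R \<inter> {v} \<times> {a<..n} = {}" "(v, w) \<in> set p" using f by blast
    have "(v, w) \<notin> R"
    proof
      assume vw: "(v, w) \<in> R"
      then have "(v, w) \<in> {1..a} \<times> {1..a} \<union> {a<..n} \<times> {a<..n}"
        using R unfolding missing_arcs_bipartite[OF a] by blast
      then have "w \<in> {a<..n}" using v(1) by simp
      then show False using v(2) vw by blast
    qed
    moreover have "(v, w) \<in> parcs (bipartite_digraph n a) \<union> R"
      using v(3) u(1) unfolding add_arcs_def by auto
    ultimately show "w \<in> {1..a}" using v(1) by (simp add: bipartite_digraph_def)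
  qed
  moreover have "inj_on f ?I"
  proof (rule inj_onI)
    fix v w assume vw: "v \<in> ?I" "w \<in> ?I" "f v = f w"
    have "(v, f v) = (w, f w)" by (rule inj_onD[OF inj _ f[OF vw(1)] f[OF vw(2)]]) (simp add: vw(3))
    then show "v = w" by simp
  qed
  ultimately show ?thesis using card_inj_on_le[of f ?I "{1..a}"] by simp
qed

lemma prob_hamiltonian_bipartite:
  fixes a n m :: nat
  defines "M \<equiv> missing_arcs (bipartite_digraph n a)" and "b \<equiv> n - a"
  assumes a: "a \<le> n" and m: "m \<le> card M"
    and q: "0 \<le> q" "q * real (card M choose m) \<le> real ((card M - b) choose m)" and qa: "real a < real b * q"
  shows "measure_pmf.prob (perturbed_digraph (bipartite_digraph n a) m) {D. hamiltonian (with_proj D)}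
    \<le> real b / (real b * q - real a)\<^sup>2"
proof -
  let ?p = "random_subset M m" and ?B = "{a<..n}"
  let ?A = "\<lambda>v. {R. R \<inter> {v} \<times> ?B = {}}"
  have M: "M = {1..a} \<times> {1..a} \<union> ?B \<times> ?B" unfolding M_def by (rule missing_arcs_bipartite[OF a])
  then have finM: "finite M" by simp
  have cB: "card ?B = b" by (simp add: b_def)
  define p1 where "p1 = real ((card M - b) choose m) / real (card M choose m)"
  have c0: "0 < real (card M choose m)" using m by simp
  have one: "measure_pmf.prob ?p (?A v) = p1" if "v \<in> ?B" for v
  proof -
    have "{v} \<times> ?B \<subseteq> M" using that by (auto simp: M)
    moreover have "card ({v} \<times> ?B) = b" by (simp add: card_cartesian_product b_def)
    ultimately show ?thesis using prob_avoid[OF finM m, of "{v} \<times> ?B"] by (simp only: p1_def)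
  qed
  have two: "measure_pmf.prob ?p (?A v \<inter> ?A w) \<le> measure_pmf.prob ?p (?A v) * measure_pmf.prob ?p (?A w)"
    if vw: "v \<in> ?B" "w \<in> ?B" "v \<noteq> w" for v w
  proof -
    have sub: "{v, w} \<times> ?B \<subseteq> M" using vw by (auto simp: M)
    have "card {v, w} = 2" using vw by simp
    then have c2: "card ({v, w} \<times> ?B) = 2 * b" using cB by (simp only: card_cartesian_product)
    then have b2: "2 * b \<le> card M" using card_mono[OF finM sub] by simp
    have "?A v \<inter> ?A w = {R. R \<inter> {v, w} \<times> ?B = {}}" by auto
    then have "measure_pmf.prob ?p (?A v \<inter> ?A w) = real ((card M - 2 * b) choose m) / real (card M choose m)"
      using prob_avoid[OF finM m sub] c2 by simp
    also have "\<dots> = real ((card M - 2 * b) choose m) * real (card M choose m) / (real (card M choose m))\<^sup>2"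
      using c0 by (simp add: power2_eq_square)
    also have "\<dots> \<le> (real ((card M - b) choose m))\<^sup>2 / (real (card M choose m))\<^sup>2"
      by (rule divide_right_mono[OF binomial_diff_log_concave[OF b2 m]]) simp
    also have "\<dots> = measure_pmf.prob ?p (?A v) * measure_pmf.prob ?p (?A w)"
      using vw by (simp add: one p1_def power2_eq_square)
    finally show ?thesis .
  qed
  have q1: "q \<le> p1" using q c0 by (simp add: p1_def field_simps)
  have \<mu>: "(\<Sum>v\<in>?B. measure_pmf.prob ?p (?A v)) = real b * p1" using one cB by simp
  have bq: "real b * q \<le> real b * p1" using q1 by (intro mult_left_mono) auto
  have "measure_pmf.prob (perturbed_digraph (bipartite_digraph n a) m) {D. hamiltonian (with_proj D)}
      = measure_pmf.prob ?p {R. hamiltonian (with_proj (add_arcs (bipartite_digraph n a) R))}"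
    unfolding perturbed_digraph_def random_subset_def M_def by (simp add: vimage_def)
  also have "\<dots> \<le> measure_pmf.prob ?p {R. real (card {v \<in> ?B. R \<in> ?A v}) \<le> real a}"
    using hamiltonian_bipartite_bound[OF a] set_pmf_random_subset[OF finM m]
    by (intro measure_pmf.finite_measure_mono_AE AE_pmfI) (auto simp: M_def)
  also have "\<dots> \<le> real (card ?B) / ((\<Sum>v\<in>?B. measure_pmf.prob ?p (?A v)) - real a)\<^sup>2"
  proof (rule few_events_unlikely)
    show "finite (set_pmf ?p)"
      unfolding set_pmf_random_subset[OF finM m] by (rule finite_subsets_of_size[OF finM m])
    show "real a < (\<Sum>v\<in>?B. measure_pmf.prob ?p (?A v))" using \<mu> bq qa by simp
  qed (use two in auto)
  also have "\<dots> = real b / (real b * p1 - real a)\<^sup>2" using \<mu> cB by simp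
  also have "\<dots> \<le> real b / (real b * q - real a)\<^sup>2"
    using bq qa by (intro divide_left_mono power_mono mult_pos_pos) auto
  finally show ?thesis .
qed

lemma exp_le_one_minus_power:
  fixes x :: real
  assumes "0 \<le> x" "x < 1"
  shows "exp (- (real m * (x / (1 - x)))) \<le> (1 - x) ^ m"
proof -
  have "1 / (1 - x) = 1 + x / (1 - x)" using assms by (simp add: field_simps)
  also have "\<dots> \<le> exp (x / (1 - x))" by (rule exp_ge_add_one_self)
  finally have "exp (- (x / (1 - x))) \<le> 1 - x" using assms by (simp add: exp_minus field_simps)
  then have "exp (- (x / (1 - x))) ^ m \<le> (1 - x) ^ m" by (intro power_mono) auto
  then show ?thesis by (simp flip: exp_of_nat_mult)
qed

text \<open>
  The probability that \<open>R\<close> has no arc from a given vertex of \<open>B\<close>, where \<open>b = card B\<close> and \<open>N\<close> is the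
  number of missing arcs. It is about \<open>exp (- m b / N) \<ge> exp (- m / b)\<close>; as \<open>b\<close> is close to \<open>9n/10\<close> or
  larger, the exponent \<open>m / b\<close> is well below \<open>\<theta>/2\<close>, and \<open>exp (- \<theta>/2) = sqrt d\<close>.
\<close>
lemma untouched_ratio:
  fixes d \<theta> :: real
  assumes d: "0 < d" "d \<le> 1 / 10" and \<theta>: "\<theta> = ln (inverse d)"
    and b: "88 / 100 * real n \<le> real b" "b \<le> n" and m: "real m < \<theta> * real n / 3"
    and N: "b * b \<le> N" and n: "100 * (1 + \<theta>) \<le> real n"
  shows "sqrt d * real (N choose m) \<le> real ((N - b) choose m)"
proof -
  have \<theta>0: "0 < \<theta>" using d \<theta> by (simp add: field_simps)
  have n0: "100 < real n" using n \<theta>0 by simp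
  have "real m < real n / 100 * real n / 3"
  proof -
    have "\<theta> \<le> real n / 100" using n by simp
    then have "\<theta> * real n / 3 \<le> real n / 100 * real n / 3" using n0 by (intro divide_right_mono mult_right_mono) auto
    then show ?thesis using m by linarith
  qed
  then have m2: "real m \<le> real n * real n / 300" by simp
  have bb: "77 / 100 * (real n * real n) \<le> real b * real b"
  proof -
    have "(88 / 100 * real n) * (88 / 100 * real n) \<le> real b * real b" using b n0 by (intro mult_mono) auto
    moreover have "77 / 100 * (real n * real n) \<le> (88 / 100 * real n) * (88 / 100 * real n)" by simp
    ultimately show ?thesis by linarith
  qed
  have bn: "real b \<le> real n * real n / 100"
  proof -
    have "real n * 100 \<le> real n * real n" using n0 by (intro mult_left_mono) auto
    then show ?thesis using b(2) by (simp add: of_nat_mono order_trans)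
  qed
  have NN: "real b * real b \<le> real N" using N by (metis of_nat_le_iff of_nat_mult)
  have nn0: "0 < real n * real n" using n0 by simp
  have gap: "7 / 10 * (real n * real n) \<le> real N - real m - real b" using bb NN m2 bn nn0 by linarith
  then have mb: "m + b < N" using nn0 by linarith
  then have Nm: "real (N - m) = real N - real m" by (simp add: of_nat_diff)
  let ?x = "real b / real (N - m)"
  have x: "0 \<le> ?x" "?x < 1" using mb by auto
  have "1 - ?x = (real N - real m - real b) / real (N - m)" using mb Nm by (simp add: field_simps)
  then have "?x / (1 - ?x) = real b / (real N - real m - real b)" using mb by simp
  also have "\<dots> \<le> real n / (7 / 10 * (real n * real n))"
    using gap b nn0 by (intro frac_le) auto
  also have "\<dots> = 10 / (7 * real n)" using n0 by simp
  finally have "real m * (?x / (1 - ?x)) \<le> (\<theta> * real n / 3) * (10 / (7 * real n))"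
    using m x \<theta>0 by (intro mult_mono) auto
  also have "\<dots> = 10 / 21 * \<theta>" using n0 by simp
  also have "\<dots> \<le> \<theta> / 2" using \<theta>0 by simp
  finally have "exp (- (\<theta> / 2)) \<le> exp (- (real m * (?x / (1 - ?x))))" by simp
  also have "\<dots> \<le> (1 - ?x) ^ m" by (rule exp_le_one_minus_power[OF x])
  finally have "exp (- (\<theta> / 2)) \<le> (1 - ?x) ^ m" .
  moreover have "exp (- (\<theta> / 2)) = sqrt d"
  proof -
    have "exp (- (\<theta> / 2)) = exp (ln d / 2)" using d by (simp add: \<theta> ln_inverse)
    also have "ln d / 2 = ln (sqrt d)" using d by (simp add: ln_sqrt)
    also have "exp (ln (sqrt d)) = sqrt d" using d by simp
    finally show ?thesis .
  qed
  ultimately have "sqrt d * real (N choose m) \<le> (1 - ?x) ^ m * real (N choose m)"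
    by (intro mult_right_mono) auto
  also have "\<dots> \<le> real ((N - b) choose m)" by (rule binomial_diff_lower) (use mb in auto)
  finally show ?thesis .
qed

theorem whp_not_hamiltonian:
  fixes d \<theta> :: real
  assumes d: "0 < d" "d \<le> 1 / 10" and \<theta>: "\<theta> = ln (inverse d)"
  defines "H \<equiv> \<lambda>n. bipartite_digraph n (nat \<lceil>d * real n\<rceil>)"
  shows "\<forall>\<^sub>F n in sequentially. H n \<in> dense_digraphs n d"
    and "(\<forall>\<^sub>F n in sequentially. m n \<le> card (missing_arcs (H n)) \<and> real (m n) < \<theta> * real n / 3) \<Longrightarrow>
      whp (\<lambda>n. perturbed_digraph (H n) (m n)) (\<lambda>D. \<not> hamiltonian (with_proj D))"
proof -
  define a where "a n = nat \<lceil>d * real n\<rceil>" for n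
  have H: "H n = bipartite_digraph n (a n)" for n by (simp add: H_def a_def)
  have a: "d * real n \<le> real (a n)" "real (a n) \<le> d * real n + 1" for n
    using d ceiling_correct[of "d * real n"] unfolding a_def by auto
  \<comment> \<open>For \<open>d \<le> 1/10\<close> and \<open>n \<ge> 100\<close>, rounding up gives at most \<open>12n/100\<close> vertices outside \<open>B\<close>.\<close>
  have size: "a n \<le> n \<and> real (n - a n) = real n - real (a n) \<and> 88 / 100 * real n \<le> real (n - a n)"
    if n: "100 \<le> real n" for n
  proof -
    have "d * real n \<le> 1 / 10 * real n" using d by (intro mult_right_mono) auto
    then have "real (a n) \<le> 12 / 100 * real n" using a(2)[of n] n by linarith
    moreover from this have "a n \<le> n" using n by linarith
    ultimately show ?thesis by (simp add: of_nat_diff)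
  qed
  show "\<forall>\<^sub>F n in sequentially. H n \<in> dense_digraphs n d"
    using eventually_ge_at_top[of 100]
  proof eventually_elim
    case (elim n)
    then have n: "100 \<le> real n" by linarith
    have "d * real n \<le> 1 / 10 * real n" using d by (intro mult_right_mono) auto
    then show ?case unfolding H using size[OF n] a(1)[of n] n
      by (intro bipartite_digraph_dense) auto
  qed
  have \<theta>0: "0 < \<theta>" using d \<theta> by (simp add: field_simps)
  define e where "e = 88 / 100 * sqrt d - d"
  have e: "0 < e"
  proof -
    have "sqrt d \<le> 1 / 2" using d by (intro real_le_lsqrt) (auto simp: power2_eq_square)
    then have "sqrt d * sqrt d \<le> 1 / 2 * sqrt d" using d by (intro mult_right_mono) auto
    then have "d \<le> 1 / 2 * sqrt d" using d by simp
    moreover have "0 < sqrt d" using d by simp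
    ultimately show ?thesis unfolding e_def by linarith
  qed
  assume ev: "\<forall>\<^sub>F n in sequentially. m n \<le> card (missing_arcs (H n)) \<and> real (m n) < \<theta> * real n / 3"
  let ?P = "\<lambda>n. measure_pmf.prob (perturbed_digraph (H n) (m n)) {D. \<not> hamiltonian (with_proj D)}"
  have low: "\<forall>\<^sub>F n in sequentially. 1 - real n / (e * real n - 1)\<^sup>2 \<le> ?P n"
    using ev eventually_ge_at_top[of "nat \<lceil>100 * (1 + \<theta>)\<rceil> + nat \<lceil>2 / e\<rceil>"]
  proof eventually_elim
    case (elim n)
    let ?b = "n - a n"
    have "100 * (1 + \<theta>) \<le> real n" "2 / e \<le> real n"
      using elim(2) \<theta>0 e by linarith+
    then have n: "100 * (1 + \<theta>) \<le> real n" "2 \<le> e * real n" "100 \<le> real n"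
      using \<theta>0 e by (auto simp: field_simps)
    note s = size[OF n(3)]
    have cM: "card (missing_arcs (H n)) = a n * a n + ?b * ?b"
      unfolding H using s by (intro card_missing_arcs_bipartite) auto
    have "sqrt d * real (card (missing_arcs (H n)) choose m n) \<le> real ((card (missing_arcs (H n)) - ?b) choose m n)"
      using elim(1) s n cM by (intro untouched_ratio[OF d \<theta>]) auto
    moreover have eb: "e * real n - 1 \<le> real ?b * sqrt d - real (a n)"
    proof -
      have "88 / 100 * real n * sqrt d \<le> real ?b * sqrt d" using s d by (intro mult_right_mono) auto
      then show ?thesis using a(2)[of n] by (simp add: e_def algebra_simps)
    qed
    ultimately have "measure_pmf.prob (perturbed_digraph (H n) (m n)) {D. hamiltonian (with_proj D)}
        \<le> real ?b / (real ?b * sqrt d - real (a n))\<^sup>2"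
      unfolding H
    proof (intro prob_hamiltonian_bipartite)
      show "real (a n) < real ?b * sqrt d" using eb n by linarith
    qed (use elim(1) s d in \<open>simp_all add: H\<close>)
    also have "\<dots> \<le> real n / (e * real n - 1)\<^sup>2"
    proof (rule frac_le)
      show "(e * real n - 1)\<^sup>2 \<le> (real ?b * sqrt d - real (a n))\<^sup>2"
        by (rule power_mono[OF eb]) (use n in linarith)
    qed (use n in simp_all)
    finally have "measure_pmf.prob (perturbed_digraph (H n) (m n)) {D. hamiltonian (with_proj D)}
      \<le> real n / (e * real n - 1)\<^sup>2" .
    moreover have "?P n = 1 - measure_pmf.prob (perturbed_digraph (H n) (m n)) {D. hamiltonian (with_proj D)}"
      using measure_pmf.prob_compl[of "{D. hamiltonian (with_proj D)}" "perturbed_digraph (H n) (m n)"]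
      by (simp add: set_diff_eq)
    ultimately show ?case by linarith
  qed
  have "(\<lambda>n. 1 - real n / (e * real n - 1)\<^sup>2) \<longlonglongrightarrow> 1" using e by real_asymp
  from tendsto_sandwich[OF low _ this tendsto_const]
  show "whp (\<lambda>n. perturbed_digraph (H n) (m n)) (\<lambda>D. \<not> hamiltonian (with_proj D))"
    unfolding whp_def by simp
qed

section \<open>The theorem\<close>

theorem theorem3:
  fixes d \<theta> :: real
  assumes "0 < d" and "d < 1 / 2" and "\<theta> = ln (inverse d)"
  shows
    "(\<forall>(H :: nat \<Rightarrow> nat pair_pre_digraph) (m :: nat \<Rightarrow> nat).
        (\<forall>\<^sub>F n in sequentially.
            H n \<in> dense_digraphs n d
          \<and> m n \<le> card (missing_arcs (H n))
          \<and> real (m n) \<ge> (inverse d * (15 + 6 * \<theta>) + 5 * inverse (d ^ 2)) * real n)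
        \<longrightarrow> whp (\<lambda>n. perturbed_digraph (H n) (m n)) (\<lambda>D. hamiltonian (with_proj D)))
   \<and> (d \<le> 1 / 10 \<longrightarrow>
      (\<exists>H :: nat \<Rightarrow> nat pair_pre_digraph.
          (\<forall>\<^sub>F n in sequentially. H n \<in> dense_digraphs n d)
        \<and> (\<forall>m :: nat \<Rightarrow> nat.
              (\<forall>\<^sub>F n in sequentially.
                  m n \<le> card (missing_arcs (H n)) \<and> real (m n) < \<theta> * real n / 3)
              \<longrightarrow> whp (\<lambda>n. perturbed_digraph (H n) (m n))
                    (\<lambda>D. \<not> hamiltonian (with_proj D)))))"
proof -
  have "whp (\<lambda>n. perturbed_digraph (H n) (m n)) (\<lambda>D. hamiltonian (with_proj D))"
    if "\<forall>\<^sub>F n in sequentially. H n \<in> dense_digraphs n d \<and> m n \<le> card (missing_arcs (H n)) \<and>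
      real (m n) \<ge> (inverse d * (15 + 6 * \<theta>) + 5 * inverse (d ^ 2)) * real n"
    for H :: "nat \<Rightarrow> nat pair_pre_digraph" and m
    by (rule whp_hamiltonian[OF assms that])
  moreover have "\<exists>H :: nat \<Rightarrow> nat pair_pre_digraph.
          (\<forall>\<^sub>F n in sequentially. H n \<in> dense_digraphs n d)
        \<and> (\<forall>m :: nat \<Rightarrow> nat.
              (\<forall>\<^sub>F n in sequentially.
                  m n \<le> card (missing_arcs (H n)) \<and> real (m n) < \<theta> * real n / 3)
              \<longrightarrow> whp (\<lambda>n. perturbed_digraph (H n) (m n))
                    (\<lambda>D. \<not> hamiltonian (with_proj D)))" if "d \<le> 1 / 10"
    using whp_not_hamiltonian[OF assms(1) that assms(3)]
    by (intro exI[of _ "\<lambda>n. bipartite_digraph n (nat \<lceil>d * real n\<rceil>)"] conjI allI impI)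
  ultimately show ?thesis by blast
qed

end
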